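(* Let $n\ge 2$ and let $\Omega\subset\mathbb{R}^n$ be a nonempty open cone with vertex at the origin (that is, $\lambda\Omega=\Omega$ for every $\lambda>0$) such that $\Omega\subset\{x\in\mathbb{R}^n: x_n>0\}$ and $\partial\Omega\setminus\{0\}$ is a $C^{1,\beta}$ hypersurface for some $\beta>0$. Let $f\in C^1(\mathbb{R})$ and $c\in\mathbb{R}$. Suppose $u\in C^2(\Omega)\cap C^1(\overline{\Omega}\setminus\{0\})\cap W^{1,\infty}(\Omega)$ satisfies $$\Delta u+f(u)=0,\quad u>0\ \text{ in }\Omega;\qquad u=0,\quad \partial_\nu u=c\ \text{ on }\partial\Omega\setminus\{0\},$$ where $\nu$ is the exterior unit normal to $\partial\Omega\setminus\{0\}$. Then $\Omega=\{x\in\mathbb{R}^n: x_n>0\}$. *)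

theory Defs
  imports "HOL-Analysis.Analysis"
begin

definition open_cone :: "(real^'n) set \<Rightarrow> bool" where
  "open_cone \<Omega> \<longleftrightarrow> open \<Omega> \<and> \<Omega> \<noteq> {} \<and> (\<forall>l>0. (\<lambda>x. l *\<^sub>R x) ` \<Omega> = \<Omega>)"

definition local_C1beta_defining ::
  "(real^'n) set \<Rightarrow> real \<Rightarrow> real^'n \<Rightarrow> real \<Rightarrow> (real^'n \<Rightarrow> real) \<Rightarrow> (real^'n \<Rightarrow> real^'n) \<Rightarrow> bool" where
  "local_C1beta_defining \<Omega> \<beta> p r \<phi> D\<phi> \<longleftrightarrow>
     r > 0 \<and>
     (\<forall>x\<in>ball p r. (\<phi> has_derivative (\<lambda>h. D\<phi> x \<bullet> h)) (at x)) \<and>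
     (\<exists>L. \<forall>x\<in>ball p r. \<forall>y\<in>ball p r. norm (D\<phi> x - D\<phi> y) \<le> L * dist x y powr \<beta>) \<and>
     D\<phi> p \<noteq> 0 \<and>
     \<Omega> \<inter> ball p r = {x \<in> ball p r. \<phi> x < 0} \<and>
     frontier \<Omega> \<inter> ball p r = {x \<in> ball p r. \<phi> x = 0}"

definition C1beta_boundary_off0 :: "(real^'n) set \<Rightarrow> real \<Rightarrow> bool" where
  "C1beta_boundary_off0 \<Omega> \<beta> \<longleftrightarrow>
     (\<forall>p \<in> frontier \<Omega> - {0}. \<exists>r \<phi> D\<phi>. local_C1beta_defining \<Omega> \<beta> p r \<phi> D\<phi>)"

definition exterior_normal :: "(real^'n) set \<Rightarrow> real^'n \<Rightarrow> real^'n \<Rightarrow> bool" where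
  "exterior_normal \<Omega> p \<nu> \<longleftrightarrow>
     (\<exists>\<beta> r \<phi> D\<phi>. \<beta> > 0 \<and> local_C1beta_defining \<Omega> \<beta> p r \<phi> D\<phi> \<and>
        \<nu> = D\<phi> p /\<^sub>R norm (D\<phi> p))"

end

(* Suppose the cone is strictly smaller than the half-space x_k > 0. Then a subsolution
   v (Laplacian bounded below, bounded above, v <= 0 on the boundary off the vertex)
   satisfies v = o(1) * x_k at the vertex: comparison with a multiple of x_k on a dilated
   ball gains a fixed factor less than 1 at every scale, because v <= 0 near a point of the
   half-space outside the cone. No regularity at the vertex is needed.
   - For v = u, rescaled barriers at an exterior touching ball (which the cone structure
     dilates to every scale) give -c <= 0; positivity of u gives c <= 0. Hence c = 0, and
     positivity along all inward directions forces the whole gradient to vanish on the boundary.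
   - If f(0) >= 0, the Hopf lemma at an interior touching ball contradicts c = 0.
   - If f(0) < 0, the result applies to every directional derivative of u, so that
     |grad u| = o(|x|), which is incompatible with laplace u >= -f(0)/2 > 0 near the vertex. *)

theory Submission
  imports Defs
begin

section \<open>Laplacians along coordinate lines\<close>

text \<open>The decay rests on the normalization v(\<rho> x)/\<rho>: it preserves linear bounds m
  x_k, while a bounded right-hand side is multiplied by \<rho> and dies out under blow-up. A gain
  from m to \<theta> m at one scale therefore repeats at all smaller ones, and the best slope at the
  vertex must be 0. In the full half-space x_k itself shows that no gain is possible. Two obstacles
  shape the rest. As f is only C^1 and u only C^2, derivatives of u need not be twice
  differentiable; subsolutions are therefore tested by touching functions, so that one decay theorem
  covers u and its derivatives alike. And a C^{1,beta} boundary need not have a touching ball at a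
  given point; a frontier point nearest to a point off the frontier always has one, and since c is
  constant one such point is enough. The sign of f(0) matters because Hopf's lemma uses laplace u <=
  L u, which fails near the boundary if f(0) < 0: there u may vanish quadratically with c = 0, and
  the contradiction has to be found at the vertex.\<close>

definition has_d2 :: "(real \<Rightarrow> real) \<Rightarrow> real \<Rightarrow> real \<Rightarrow> bool" where
  "has_d2 \<phi> a b \<longleftrightarrow>
     (\<exists>g. (\<forall>\<^sub>F s in nhds 0. (\<phi> has_real_derivative g s) (at s)) \<and> g 0 = a \<and>
          (g has_real_derivative b) (at 0))"

lemma has_d2_imp_deriv: "has_d2 \<phi> a b \<Longrightarrow> (\<phi> has_real_derivative a) (at 0)"
  unfolding has_d2_def by (auto dest: eventually_nhds_x_imp_x)

lemma has_d2_add: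
  assumes "has_d2 \<phi> a b" "has_d2 \<psi> c d"
  shows "has_d2 (\<lambda>s. \<phi> s + \<psi> s) (a + c) (b + d)"
proof -
  from assms obtain g h where
    g: "\<forall>\<^sub>F s in nhds 0. (\<phi> has_real_derivative g s) (at s)" "g 0 = a" "(g has_real_derivative b) (at 0)" and
    h: "\<forall>\<^sub>F s in nhds 0. (\<psi> has_real_derivative h s) (at s)" "h 0 = c" "(h has_real_derivative d) (at 0)"
    unfolding has_d2_def by blast
  have "\<forall>\<^sub>F s in nhds 0. ((\<lambda>s. \<phi> s + \<psi> s) has_real_derivative g s + h s) (at s)"
    using g(1) h(1) by eventually_elim (rule DERIV_add)
  then show ?thesis unfolding has_d2_def
    using g h by (intro exI[of _ "\<lambda>s. g s + h s"]) (auto intro!: DERIV_add)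
qed

lemma has_d2_mult:
  assumes "has_d2 \<phi> a b" "has_d2 \<psi> c d"
  shows "has_d2 (\<lambda>s. \<phi> s * \<psi> s) (a * \<psi> 0 + \<phi> 0 * c) (b * \<psi> 0 + 2 * a * c + \<phi> 0 * d)"
proof -
  from assms obtain g h where
    g: "\<forall>\<^sub>F s in nhds 0. (\<phi> has_real_derivative g s) (at s)" "g 0 = a" "(g has_real_derivative b) (at 0)" and
    h: "\<forall>\<^sub>F s in nhds 0. (\<psi> has_real_derivative h s) (at s)" "h 0 = c" "(h has_real_derivative d) (at 0)"
    unfolding has_d2_def by blast
  have "\<forall>\<^sub>F s in nhds 0. ((\<lambda>s. \<phi> s * \<psi> s) has_real_derivative g s * \<psi> s + h s * \<phi> s) (at s)"
    using g(1) h(1) by eventually_elim (rule DERIV_mult)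
  moreover have "((\<lambda>s. g s * \<psi> s + h s * \<phi> s) has_real_derivative
      (b * \<psi> 0 + c * g 0) + (d * \<phi> 0 + a * h 0)) (at 0)"
    by (intro DERIV_add DERIV_mult g h has_d2_imp_deriv[OF assms(1)] has_d2_imp_deriv[OF assms(2)])
  ultimately show ?thesis unfolding has_d2_def
    using g h by (intro exI[of _ "\<lambda>s. g s * \<psi> s + h s * \<phi> s"]) (auto simp: algebra_simps)
qed

lemma has_d2_const: "has_d2 (\<lambda>s. c) 0 0"
  unfolding has_d2_def by (rule exI[of _ "\<lambda>s. 0"]) auto

lemma has_d2_affine: "has_d2 (\<lambda>s. c + s * m) m 0"
  unfolding has_d2_def
  by (rule exI[of _ "\<lambda>s. m"]) (auto intro!: always_eventually derivative_eq_intros)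

lemma has_d2_compose:
  assumes "has_d2 \<phi> a b"
    and F: "\<forall>\<^sub>F y in nhds (\<phi> 0). (F has_real_derivative F' y) (at y)"
    and F': "(F' has_real_derivative c) (at (\<phi> 0))"
  shows "has_d2 (\<lambda>s. F (\<phi> s)) (F' (\<phi> 0) * a) (c * a\<^sup>2 + F' (\<phi> 0) * b)"
proof -
  from assms obtain g where
    g: "\<forall>\<^sub>F s in nhds 0. (\<phi> has_real_derivative g s) (at s)" "g 0 = a" "(g has_real_derivative b) (at 0)"
    unfolding has_d2_def by blast
  have "isCont \<phi> 0" using has_d2_imp_deriv[OF assms(1)] DERIV_isCont by blast
  then have "filterlim \<phi> (nhds (\<phi> 0)) (nhds 0)"
    by (simp add: isCont_def tendsto_at_iff_tendsto_nhds)
  then have "\<forall>\<^sub>F s in nhds 0. (F has_real_derivative F' (\<phi> s)) (at (\<phi> s))"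
    using F by (auto simp: filterlim_iff)
  with g(1) have "\<forall>\<^sub>F s in nhds 0. ((\<lambda>s. F (\<phi> s)) has_real_derivative F' (\<phi> s) * g s) (at s)"
    by eventually_elim (rule DERIV_chain2)
  moreover have "((\<lambda>s. F' (\<phi> s) * g s) has_real_derivative (c * a) * g 0 + b * F' (\<phi> 0)) (at 0)"
    by (intro DERIV_mult g DERIV_chain2[OF F' has_d2_imp_deriv[OF assms(1)]])
  ultimately show ?thesis unfolding has_d2_def
    using g by (intro exI[of _ "\<lambda>s. F' (\<phi> s) * g s"]) (auto simp: algebra_simps power2_eq_square)
qed

text \<open>At a maximum the derivative \<open>g\<close> vanishes; b > 0 would make \<open>g\<close>
  positive just to the right of 0, and the mean value theorem would push \<open>\<phi>\<close> above
  \<open>\<phi> 0\<close>.\<close>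

lemma has_d2_local_max:
  assumes "has_d2 \<phi> a b" and mx: "\<forall>\<^sub>F s in nhds 0. \<phi> s \<le> \<phi> 0"
  shows "b \<le> 0"
proof (rule ccontr)
  assume "\<not> b \<le> 0" then have b: "b > 0" by simp
  from assms obtain g where
    g: "\<forall>\<^sub>F s in nhds 0. (\<phi> has_real_derivative g s) (at s)" "g 0 = a" "(g has_real_derivative b) (at 0)"
    unfolding has_d2_def by blast
  from mx g(1) have "\<forall>\<^sub>F s in nhds 0. \<phi> s \<le> \<phi> 0 \<and> (\<phi> has_real_derivative g s) (at s)"
    by eventually_elim auto
  then obtain e where e: "e > 0" and
    E: "\<And>s. \<bar>s\<bar> < e \<Longrightarrow> \<phi> s \<le> \<phi> 0 \<and> (\<phi> has_real_derivative g s) (at s)"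
    unfolding eventually_nhds_metric by (auto simp: dist_real_def)
  have a: "g 0 = 0"
    by (rule DERIV_local_max[of \<phi> _ 0 e]) (use E e in auto)
  obtain d where d: "d > 0" "\<And>h. h > 0 \<Longrightarrow> h < d \<Longrightarrow> g 0 < g (0 + h)"
    using DERIV_pos_inc_right[OF g(3) b] by blast
  define s where "s = min d e / 2"
  have s: "0 < s" "s < d" "s < e" using d e by (auto simp: s_def)
  obtain \<xi> where "0 < \<xi>" "\<xi> < s" "\<phi> s - \<phi> 0 = (s - 0) * g \<xi>"
    using MVT2[of 0 s \<phi> g] E s by auto
  moreover have "g \<xi> > 0" using d(2)[of \<xi>] calculation s a by auto
  ultimately show False using E[of s] s
    by (smt (verit) mult_pos_pos)
qed

text \<open>Only second derivatives along the coordinate lines through \<open>x\<close> are required. The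
  partial derivatives are recorded in \<open>d\<close> for the product and chain rules.\<close>

definition has_lap :: "(real^'n \<Rightarrow> real) \<Rightarrow> real^'n \<Rightarrow> real^'n \<Rightarrow> real \<Rightarrow> bool" where
  "has_lap z x d l \<longleftrightarrow>
     (\<exists>h. (\<forall>i. has_d2 (\<lambda>s. z (x + s *\<^sub>R axis i 1)) (d $ i) (h i)) \<and> l = sum h UNIV)"

lemma has_lap_add:
  assumes "has_lap z x d l" "has_lap w x e m"
  shows "has_lap (\<lambda>x. z x + w x) x (d + e) (l + m)"
proof -
  from assms obtain h k where
    "\<forall>i. has_d2 (\<lambda>s. z (x + s *\<^sub>R axis i 1)) (d $ i) (h i)" "l = sum h UNIV"
    "\<forall>i. has_d2 (\<lambda>s. w (x + s *\<^sub>R axis i 1)) (e $ i) (k i)" "m = sum k UNIV"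
    unfolding has_lap_def by blast
  then show ?thesis unfolding has_lap_def
    by (intro exI[of _ "\<lambda>i. h i + k i"]) (auto intro!: has_d2_add simp: sum.distrib)
qed

lemma has_lap_const: "has_lap (\<lambda>x. c) x 0 0"
  unfolding has_lap_def by (intro exI[of _ "\<lambda>i. 0"]) (auto intro: has_d2_const)

lemma has_lap_coord: "has_lap (\<lambda>x. x $ k) x (axis k 1) 0"
  unfolding has_lap_def
proof (intro exI[of _ "\<lambda>i. 0"] conjI allI)
  fix i
  show "has_d2 (\<lambda>s. (x + s *\<^sub>R axis i 1) $ k) (axis k 1 $ i) 0"
  proof -
    have "axis k 1 $ i = (axis i 1 $ k :: real)" by (simp add: axis_def)
    then show ?thesis
      using has_d2_affine[of "x $ k" "axis i 1 $ k"] by simp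
  qed
qed auto

lemma has_lap_mult:
  assumes "has_lap z x d l" "has_lap w x e m"
  shows "has_lap (\<lambda>x. z x * w x) x (w x *\<^sub>R d + z x *\<^sub>R e) (l * w x + 2 * (d \<bullet> e) + z x * m)"
proof -
  from assms obtain h k where *:
    "\<forall>i. has_d2 (\<lambda>s. z (x + s *\<^sub>R axis i 1)) (d $ i) (h i)" "l = sum h UNIV"
    "\<forall>i. has_d2 (\<lambda>s. w (x + s *\<^sub>R axis i 1)) (e $ i) (k i)" "m = sum k UNIV"
    unfolding has_lap_def by blast
  have "has_d2 (\<lambda>s. z (x + s *\<^sub>R axis i 1) * w (x + s *\<^sub>R axis i 1))
      (d $ i * w x + z x * e $ i) (h i * w x + 2 * d $ i * e $ i + z x * k i)" for i
    using has_d2_mult[OF *(1)[rule_format, of i] *(3)[rule_format, of i]] by simp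
  then show ?thesis unfolding has_lap_def
    by (intro exI[of _ "\<lambda>i. h i * w x + 2 * d $ i * e $ i + z x * k i"])
       (auto simp: * sum.distrib sum_distrib_left sum_distrib_right inner_vec_def algebra_simps)
qed

lemma has_lap_cmult: "has_lap z x d l \<Longrightarrow> has_lap (\<lambda>x. c * z x) x (c *\<^sub>R d) (c * l)"
  using has_lap_mult[OF has_lap_const[of c x]] by fastforce

lemma has_lap_diff:
  assumes "has_lap z x d l" "has_lap w x e m"
  shows "has_lap (\<lambda>x. z x - w x) x (d - e) (l - m)"
  using has_lap_add[OF assms(1) has_lap_cmult[OF assms(2), of "-1"]] by simp

lemma has_lap_compose:
  assumes "has_lap z x d l"
    and F: "\<forall>\<^sub>F y in nhds (z x). (F has_real_derivative F' y) (at y)"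
    and F': "(F' has_real_derivative c) (at (z x))"
  shows "has_lap (\<lambda>x. F (z x)) x (F' (z x) *\<^sub>R d) (c * (norm d)\<^sup>2 + F' (z x) * l)"
proof -
  from assms obtain h where *:
    "\<forall>i. has_d2 (\<lambda>s. z (x + s *\<^sub>R axis i 1)) (d $ i) (h i)" "l = sum h UNIV"
    unfolding has_lap_def by blast
  have "has_d2 (\<lambda>s. F (z (x + s *\<^sub>R axis i 1))) (F' (z x) * d $ i)
      (c * (d $ i)\<^sup>2 + F' (z x) * h i)" for i
    using has_d2_compose[OF *(1)[rule_format, of i], of F F' c] F F' by simp
  moreover have "(norm d)\<^sup>2 = (\<Sum>i\<in>UNIV. (d $ i)\<^sup>2)"
    unfolding power2_norm_eq_inner inner_vec_def by (simp add: power2_eq_square)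
  ultimately show ?thesis unfolding has_lap_def
    by (intro exI[of _ "\<lambda>i. c * (d $ i)\<^sup>2 + F' (z x) * h i"])
       (auto simp: * sum.distrib sum_distrib_left)
qed

lemma has_lap_local_max:
  assumes "has_lap z x d l" and "r > 0" and mx: "\<And>y. y \<in> ball x r \<Longrightarrow> z y \<le> z x"
  shows "l \<le> 0"
proof -
  from assms obtain h where *:
    "\<forall>i. has_d2 (\<lambda>s. z (x + s *\<^sub>R axis i 1)) (d $ i) (h i)" "l = sum h UNIV"
    unfolding has_lap_def by blast
  have "h i \<le> 0" for i
  proof (rule has_d2_local_max[OF *(1)[rule_format]])
    show "\<forall>\<^sub>F s in nhds 0. z (x + s *\<^sub>R axis i 1) \<le> z (x + 0 *\<^sub>R axis i 1)"
      unfolding eventually_nhds_metric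
      by (rule exI[of _ r]) (use assms(2) mx in \<open>auto simp: dist_norm\<close>)
  qed
  then show ?thesis by (simp add: * sum_nonpos)
qed

lemma has_lap_sqdist:
  fixes x a :: "real^'n"
  shows "has_lap (\<lambda>x. (norm (x - a))\<^sup>2) x (2 *\<^sub>R (x - a)) (2 * CARD('n))"
proof -
  have "has_d2 (\<lambda>s. (norm (x + s *\<^sub>R axis i 1 - a))\<^sup>2) ((2 *\<^sub>R (x - a)) $ i) 2" for i
  proof -
    have "has_d2 (\<lambda>s. (norm (x - a))\<^sup>2 + (2 * (x - a) $ i * s + s\<^sup>2)) (2 * (x - a) $ i) 2"
      unfolding has_d2_def
      by (rule exI[of _ "\<lambda>s. 2 * (x - a) $ i + 2 * s"])
         (auto intro!: always_eventually derivative_eq_intros)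
    moreover have "(norm (x + s *\<^sub>R axis i 1 - a))\<^sup>2 = (norm (x - a))\<^sup>2 + (2 * (x - a) $ i * s + s\<^sup>2)" for s
    proof -
      have "x + s *\<^sub>R axis i 1 - a = (x - a) + s *\<^sub>R axis i 1" by simp
      then show ?thesis
        by (simp only: power2_norm_eq_inner)
           (simp add: inner_add_left inner_add_right inner_axis inner_axis' power2_eq_square algebra_simps)
    qed
    ultimately show ?thesis by simp
  qed
  then show ?thesis unfolding has_lap_def by (intro exI[of _ "\<lambda>i. 2"]) auto
qed

lemma has_lap_translate:
  assumes "has_lap z (x + a) d l" shows "has_lap (\<lambda>x. z (x + a)) x d l"
  using assms unfolding has_lap_def by (simp add: algebra_simps)

lemma has_lap_scale:
  assumes "has_lap z (r *\<^sub>R x) d l" shows "has_lap (\<lambda>x. z (r *\<^sub>R x)) x (r *\<^sub>R d) (r\<^sup>2 * l)"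
proof -
  from assms obtain h where *:
    "\<forall>i. has_d2 (\<lambda>s. z (r *\<^sub>R x + s *\<^sub>R axis i 1)) (d $ i) (h i)" "l = sum h UNIV"
    unfolding has_lap_def by blast
  have "has_d2 (\<lambda>s. z (r *\<^sub>R (x + s *\<^sub>R axis i 1))) (r * d $ i) (r\<^sup>2 * h i)" for i
  proof -
    obtain g where g: "\<forall>\<^sub>F s in nhds 0. ((\<lambda>s. z (r *\<^sub>R x + s *\<^sub>R axis i 1)) has_real_derivative g s) (at s)"
      "g 0 = d $ i" "(g has_real_derivative h i) (at 0)"
      using *(1) unfolding has_d2_def by blast
    have "filterlim (\<lambda>s. r * s) (nhds 0) (nhds 0)"
      by (rule tendsto_eq_intros filterlim_ident | simp)+
    then have "\<forall>\<^sub>F s in nhds 0. ((\<lambda>s. z (r *\<^sub>R x + s *\<^sub>R axis i 1)) has_real_derivative g (r * s)) (at (r * s))"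
      using g(1) by (auto simp: filterlim_iff)
    then have "\<forall>\<^sub>F s in nhds 0. ((\<lambda>s. z (r *\<^sub>R x + (r * s) *\<^sub>R axis i 1)) has_real_derivative g (r * s) * r) (at s)"
    proof eventually_elim
      case (elim s)
      show ?case
        using DERIV_chain2[where f="\<lambda>s. z (r *\<^sub>R x + s *\<^sub>R axis i 1)" and g="\<lambda>s. r * s", OF elim DERIV_cmult_Id]
          by simp
    qed
    moreover have "((\<lambda>s. g (r * s) * r) has_real_derivative r\<^sup>2 * h i) (at 0)"
    proof -
      have "((\<lambda>s. g (r * s)) has_real_derivative h i * r) (at 0)"
        using DERIV_chain2[where f=g and g="\<lambda>s. r * s" and x=0, OF _ DERIV_cmult_Id] g(3) by simp
      then show ?thesis
        by (auto intro!: derivative_eq_intros simp: power2_eq_square)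
    qed
    ultimately show ?thesis unfolding has_d2_def
      using g(2) by (intro exI[of _ "\<lambda>s. g (r * s) * r"]) (auto simp: algebra_simps)
  qed
  then show ?thesis unfolding has_lap_def
    by (intro exI[of _ "\<lambda>i. r\<^sup>2 * h i"]) (auto simp: * sum_distrib_left)
qed

text \<open>Restricting to the i-th coordinate line leaves the i-th diagonal entry of the Hessian,
  so the trace in the equation is the Laplacian in the sense of \<open>has_lap\<close>.\<close>

lemma has_lap_of_hessian:
  fixes H :: "real^'n \<Rightarrow> real^'n^'n"
  assumes op: "open S" "x \<in> S"
    and u: "\<And>x. x \<in> S \<Longrightarrow> (u has_derivative (\<lambda>h. G x \<bullet> h)) (at x)"
    and G: "\<And>x. x \<in> S \<Longrightarrow> (G has_derivative (\<lambda>h. H x *v h)) (at x)"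
  shows "has_lap u x (G x) (\<Sum>i\<in>UNIV. H x $ i $ i)"
  unfolding has_lap_def
proof (intro exI[of _ "\<lambda>i. H x $ i $ i"] conjI allI refl)
  fix i :: 'n
  let ?p = "\<lambda>s. x + s *\<^sub>R axis i 1"
  have p: "(?p has_derivative (\<lambda>h. h *\<^sub>R axis i 1)) (at s)" for s
    by (auto intro!: derivative_eq_intros)
  obtain e where e: "e > 0" "ball x e \<subseteq> S" using op openE by blast
  have "((\<lambda>s. u (?p s)) has_real_derivative G (?p s) $ i) (at s)" if "\<bar>s\<bar> < e" for s :: real
  proof -
    have "?p s \<in> S" using e that by (auto simp: dist_norm subset_iff)
    from has_derivative_compose[OF p u[OF this]]
    have "((\<lambda>s. u (?p s)) has_derivative (\<lambda>h. h * G (?p s) $ i)) (at s)"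
      by (simp add: inner_axis)
    then show ?thesis
      by (rule has_derivative_imp_has_field_derivative) simp
  qed
  then have ev: "\<forall>\<^sub>F s in nhds 0. ((\<lambda>s. u (?p s)) has_real_derivative G (?p s) $ i) (at s)"
    unfolding eventually_nhds_metric using e(1) by (intro exI[of _ e]) (auto simp: dist_real_def)
  have "(G has_derivative (\<lambda>h. H x *v h)) (at (?p 0))" using G op by simp
  from has_derivative_compose[OF p this]
  have "((\<lambda>s. G (?p s)) has_derivative (\<lambda>h. H x *v (h *\<^sub>R axis i 1))) (at 0)" .
  then have "((\<lambda>s. G (?p s) $ i) has_derivative (\<lambda>h. (H x *v (h *\<^sub>R axis i 1)) $ i)) (at 0)"
    by (rule bounded_linear.has_derivative[OF bounded_linear_vec_nth])
  moreover have "(H x *v (h *\<^sub>R axis i 1)) $ i = H x $ i $ i * h" for h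
    by (simp add: matrix_vector_mult_scaleR matrix_vector_mult_basis column_def)
  ultimately have "((\<lambda>s. G (?p s) $ i) has_real_derivative H x $ i $ i) (at 0)"
    unfolding has_field_derivative_def by (simp only:)
  with ev show "has_d2 (\<lambda>s. u (?p s)) (G x $ i) (H x $ i $ i)"
    unfolding has_d2_def by (intro exI[of _ "\<lambda>s. G (?p s) $ i"]) auto
qed

section \<open>Radial powers and the quadratic corrector\<close>

lemma DERIV_inverse_power:
  fixes y :: real
  assumes "y > 0"
  shows "((\<lambda>y. inverse y ^ m) has_real_derivative - (m * inverse y ^ (m + 1))) (at y)"
proof -
  have "((\<lambda>y. inverse y ^ m) has_real_derivative
      m * (- (inverse y ^ Suc (Suc 0)) * inverse y ^ (m - Suc 0))) (at y)"
    using DERIV_power[OF DERIV_inverse[of y], of m] assms by simp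
  then show ?thesis
    by (rule DERIV_cong) (cases m; simp)
qed

text \<open>The exponent 2N = n - 2 is the harmonic one. A larger \<open>N\<close> makes 2N + 2 - n
  positive, so the power is strictly subharmonic away from \<open>a\<close>; the barriers below take
  N = n or larger.\<close>

lemma has_lap_inv_pow:
  fixes x a :: "real^'n" and N :: nat
  assumes "x \<noteq> a"
  shows "has_lap (\<lambda>x. inverse ((norm (x - a))\<^sup>2) ^ N) x
    ((- (N * inverse ((norm (x - a))\<^sup>2) ^ (N + 1))) *\<^sub>R 2 *\<^sub>R (x - a))
    (2 * real N * (2 * real N + 2 - real CARD('n)) * inverse ((norm (x - a))\<^sup>2) ^ (N + 1))"
proof -
  define t where "t = (norm (x - a))\<^sup>2"
  have t: "t > 0" using assms by (simp add: t_def)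
  have "\<forall>\<^sub>F y in nhds t. y > 0"
    using t by (simp add: eventually_nhds_in_open[of "{0<..}", simplified])
  then have F: "\<forall>\<^sub>F y in nhds t. ((\<lambda>y. inverse y ^ N) has_real_derivative - (N * inverse y ^ (N + 1))) (at y)"
    by eventually_elim (rule DERIV_inverse_power)
  have F': "((\<lambda>y. - (N * inverse y ^ (N + 1))) has_real_derivative N * (N + 1) * inverse t ^ (N + 2)) (at t)"
    using DERIV_minus[OF DERIV_cmult[OF DERIV_inverse_power[OF t, of "N + 1"], of "real N"]] by (simp add: algebra_simps)
  have it: "inverse t ^ (N + 2) * t = inverse t ^ (N + 1)" using t by simp
  have "has_lap (\<lambda>x. inverse ((norm (x - a))\<^sup>2) ^ N) x
      (- (N * inverse t ^ (N + 1)) *\<^sub>R 2 *\<^sub>R (x - a))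
      (N * (N + 1) * inverse t ^ (N + 2) * (norm (2 *\<^sub>R (x - a)))\<^sup>2
        + - (N * inverse t ^ (N + 1)) * (2 * CARD('n)))"
    using has_lap_compose[OF has_lap_sqdist[of a x], where F="\<lambda>y. inverse y ^ N"
        and F'="\<lambda>y. - (N * inverse y ^ (N + 1))", OF F[unfolded t_def] F'[unfolded t_def]]
    unfolding t_def .
  moreover have "N * (N + 1) * inverse t ^ (N + 2) * (norm (2 *\<^sub>R (x - a)))\<^sup>2
        + - (N * inverse t ^ (N + 1)) * (2 * CARD('n))
      = 4 * N * (N + 1) * (inverse t ^ (N + 2) * t) - 2 * N * CARD('n) * inverse t ^ (N + 1)"
    by (simp add: t_def power_mult_distrib)
  moreover have "\<dots> = 2 * real N * (2 * real N + 2 - real CARD('n)) * inverse t ^ (N + 1)"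
    unfolding it by (simp add: algebra_simps)
  ultimately show ?thesis unfolding t_def by (simp only:)
qed

text \<open>Mean value theorem for t^-N. It turns differences of radial powers into explicit
  multiples of the difference of squared distances.\<close>

lemma inv_pow_diff_bounds:
  fixes A B :: real and N :: nat
  assumes "0 < A" "A \<le> B"
  shows "N * (B - A) * inverse B ^ (N + 1) \<le> inverse A ^ N - inverse B ^ N"
    and "inverse A ^ N - inverse B ^ N \<le> N * (B - A) * inverse A ^ (N + 1)"
proof -
  have "\<exists>\<xi>. A \<le> \<xi> \<and> \<xi> \<le> B \<and> inverse B ^ N - inverse A ^ N = (B - A) * - (N * inverse \<xi> ^ (N + 1))"
  proof (cases "A = B")
    case False
    then have "A < B" using assms by simp
    then have "\<exists>z>A. z < B \<and> inverse B ^ N - inverse A ^ N = (B - A) * - (N * inverse z ^ (N + 1))"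
      by (rule MVT2) (rule DERIV_inverse_power, use assms in linarith)
    then show ?thesis by (meson less_imp_le)
  qed auto
  then obtain \<xi> where \<xi>: "A \<le> \<xi>" "\<xi> \<le> B"
    and e: "inverse A ^ N - inverse B ^ N = N * (B - A) * inverse \<xi> ^ (N + 1)"
    by (auto simp: algebra_simps)
  have "inverse \<xi> ^ (N + 1) \<le> inverse A ^ (N + 1)" "inverse B ^ (N + 1) \<le> inverse \<xi> ^ (N + 1)"
    by (rule power_mono; use \<xi> assms in \<open>simp add: le_imp_inverse_le\<close>)+
  then show "N * (B - A) * inverse B ^ (N + 1) \<le> inverse A ^ N - inverse B ^ N"
    "inverse A ^ N - inverse B ^ N \<le> N * (B - A) * inverse A ^ (N + 1)"
    unfolding e using assms by (auto intro!: mult_left_mono)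
qed

text \<open>On the slab 0 <= x_k <= 2R this function is nonnegative and at most 2 R x_k, while its
  Laplacian is constant and negative. A multiple of it absorbs the right-hand side in the decay
  estimates without spoiling linear bounds.\<close>

lemma has_lap_coord_quadratic:
  fixes x :: "real^'n"
  shows "\<exists>d. has_lap (\<lambda>x. 2 * R * x $ k - (x $ k)\<^sup>2) x d (-2)"
proof -
  have "\<exists>d. has_lap (\<lambda>x. 2 * R * x $ k - x $ k * x $ k) x d
      (2 * R * 0 - (0 * x $ k + 2 * (axis k 1 \<bullet> (axis k 1 :: real^'n)) + x $ k * 0))"
    by (rule exI, rule has_lap_diff[OF has_lap_cmult[OF has_lap_coord] has_lap_mult[OF has_lap_coord has_lap_coord]])
  then show ?thesis by (auto simp: power2_eq_square inner_axis_axis)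
qed

section \<open>Viscosity subsolutions and comparison\<close>

text \<open>A viscosity formulation of \<open>\<Delta>v > - C\<close>: for \<open>u \<in> C\<^sup>2\<close> the
  derivatives of \<open>u\<close> need not have a Laplacian, but they still satisfy such an inequality.\<close>

definition visc_sub :: "(real^'n) set \<Rightarrow> real \<Rightarrow> (real^'n \<Rightarrow> real) \<Rightarrow> bool" where
  "visc_sub \<Omega> C v \<longleftrightarrow>
     (\<forall>x0\<in>\<Omega>. \<forall>r>0. \<forall>z. ball x0 r \<subseteq> \<Omega> \<longrightarrow> continuous_on (ball x0 r) z \<longrightarrow>
        (\<forall>x\<in>ball x0 r. \<exists>d l. has_lap z x d l \<and> l \<le> - C) \<longrightarrow>
        (\<exists>x\<in>ball x0 r. v x - z x > v x0 - z x0))"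

lemma visc_subD:
  assumes "visc_sub \<Omega> C v" "x0 \<in> \<Omega>" "r > 0" "ball x0 r \<subseteq> \<Omega>" "continuous_on (ball x0 r) z"
    and "\<And>x. x \<in> ball x0 r \<Longrightarrow> \<exists>d l. has_lap z x d l \<and> l \<le> - C"
  shows "\<exists>x\<in>ball x0 r. v x - z x > v x0 - z x0"
  using assms unfolding visc_sub_def by blast

text \<open>As l > - C is strict, \<open>v - z\<close> has positive Laplacian at \<open>x0\<close>
  for every test function \<open>z\<close>, which excludes a local maximum.\<close>

lemma visc_sub_of_has_lap:
  assumes "\<And>x. x \<in> \<Omega> \<Longrightarrow> \<exists>d l. has_lap v x d l \<and> l > - C"
  shows "visc_sub \<Omega> C v"
  unfolding visc_sub_def
proof (intro ballI allI impI)
  fix x0 r z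
  assume x0: "x0 \<in> \<Omega>" and r: "(r::real) > 0"
    and z: "\<forall>x\<in>ball x0 r. \<exists>d l. has_lap z x d l \<and> l \<le> - C"
  obtain d l where l: "has_lap v x0 d l" "l > - C" using assms[OF x0] by blast
  obtain e m where m: "has_lap z x0 e m" "m \<le> - C" using z r by (meson centre_in_ball)
  show "\<exists>x\<in>ball x0 r. v x - z x > v x0 - z x0"
  proof (rule ccontr)
    assume "\<not> ?thesis"
    then have "l - m \<le> 0"
      by (intro has_lap_local_max[OF has_lap_diff[OF l(1) m(1)] r]) (auto simp: not_less)
    with l m show False by simp
  qed
qed

text \<open>Nothing is known about \<open>v\<close> at the vertex, so \<open>origin\<close> replaces
  the boundary inequality there. Away from the vertex a positive excess of \<open>v\<close> over
  \<open>z\<close> attains its maximum on a compact set, and touching by \<open>z\<close> at that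
  point contradicts \<open>visc_sub\<close>.\<close>

lemma visc_comparison:
  fixes v z :: "real^'n \<Rightarrow> real"
  assumes D: "open D" "bounded D" "D \<subseteq> \<Omega>"
    and vis: "visc_sub \<Omega> C v"
    and cv: "continuous_on (closure \<Omega> - {0}) v"
    and cz: "continuous_on (closure D - {0}) z" "0 \<notin> D"
    and lap: "\<And>x. x \<in> D \<Longrightarrow> \<exists>d l. has_lap z x d l \<and> l \<le> - C"
    and bd: "\<And>y. y \<in> frontier D \<Longrightarrow> y \<noteq> 0 \<Longrightarrow> v y \<le> z y"
    and origin: "\<And>\<delta>. \<delta> > 0 \<Longrightarrow> \<exists>r>0. \<forall>x\<in>D. norm x < r \<longrightarrow> v x - z x \<le> \<delta>"
    and x: "x \<in> D"
  shows "v x \<le> z x"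
proof (rule ccontr)
  assume "\<not> ?thesis"
  then have pos: "v x - z x > 0" by simp
  \<comment> \<open>Half the excess at \<open>x\<close>: near the vertex the difference stays below
    it, so removing a small ball does not lose the maximum.\<close>
  define \<delta> where "\<delta> = (v x - z x) / 2"
  obtain r where r: "r > 0" "\<And>y. y \<in> D \<Longrightarrow> norm y < r \<Longrightarrow> v y - z y \<le> \<delta>"
    using origin[of \<delta>] pos unfolding \<delta>_def by auto
  define K where "K = closure D - ball 0 r"
  have K: "compact K" unfolding K_def using D by (simp add: compact_diff)
  have xK: "x \<in> K"
    using x r(2)[OF x] pos closure_subset[of D] unfolding K_def \<delta>_def by fastforce
  have K0: "K \<subseteq> closure D - {0}" "K \<subseteq> closure \<Omega> - {0}"
    using r(1) closure_mono[OF D(3)] by (auto simp: K_def)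
  have "continuous_on K (\<lambda>y. v y - z y)"
    by (intro continuous_on_diff continuous_on_subset[OF cv] continuous_on_subset[OF cz(1)] K0)
  then obtain y where y: "y \<in> K" "\<And>w. w \<in> K \<Longrightarrow> v w - z w \<le> v y - z y"
    using continuous_attains_sup[OF K] xK by blast
  have big: "v y - z y \<ge> v x - z x" using y(2)[OF xK] .
  have "y \<noteq> 0" using y(1) r(1) by (auto simp: K_def)
  then have "y \<notin> frontier D" using bd[of y] big pos by fastforce
  then have yD: "y \<in> D" using y(1) D(1) by (auto simp: K_def frontier_def interior_open)
  have max: "v w - z w \<le> v y - z y" if "w \<in> D" for w
  proof (cases "norm w < r")
    case True then show ?thesis using r(2)[OF that True] big pos unfolding \<delta>_def by simp
  next
    case False then show ?thesis using y(2)[of w] that closure_subset[of D] by (auto simp: K_def)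
  qed
  obtain e where e: "e > 0" "ball y e \<subseteq> D" using D(1) yD openE by blast
  have "continuous_on (ball y e) z"
    using cz(2) e(2) closure_subset[of D] by (intro continuous_on_subset[OF cz(1)]) auto
  then have "\<exists>w\<in>ball y e. v w - z w > v y - z y"
    using e D(3) yD lap by (intro visc_subD[OF vis]) auto
  then show False using max e(2) by fastforce
qed

section \<open>Subsolutions on the cone and their dilations\<close>

definition cone_sub :: "(real^'n) set \<Rightarrow> real \<Rightarrow> (real^'n \<Rightarrow> real) \<Rightarrow> bool" where
  "cone_sub \<Omega> C v \<longleftrightarrow> continuous_on (closure \<Omega> - {0}) v \<and>
     (\<forall>p\<in>frontier \<Omega> - {0}. v p \<le> 0) \<and> visc_sub \<Omega> C v"

lemma open_cone_scale:
  assumes "open_cone \<Omega>" "\<rho> > 0"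
  shows "\<rho> *\<^sub>R x \<in> \<Omega> \<longleftrightarrow> x \<in> \<Omega>"
proof -
  have e: "(\<lambda>x. \<rho> *\<^sub>R x) ` \<Omega> = \<Omega>" using assms unfolding open_cone_def by blast
  show ?thesis
  proof
    assume "\<rho> *\<^sub>R x \<in> \<Omega>"
    then have "\<rho> *\<^sub>R x \<in> (\<lambda>x. \<rho> *\<^sub>R x) ` \<Omega>" by (simp add: e)
    then show "x \<in> \<Omega>" using assms(2) by auto
  next
    assume "x \<in> \<Omega>" then show "\<rho> *\<^sub>R x \<in> \<Omega>" using e by blast
  qed
qed

lemma open_cone_closure_scale:
  assumes "open_cone \<Omega>" "\<rho> > 0" "x \<in> closure \<Omega>"
  shows "\<rho> *\<^sub>R x \<in> closure \<Omega>"
proof -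
  have "(\<lambda>x. \<rho> *\<^sub>R x) ` \<Omega> = \<Omega>" using assms unfolding open_cone_def by blast
  then show ?thesis using closure_scaleR[of \<rho> \<Omega>] assms(3) by auto
qed

text \<open>Division by \<open>\<rho>\<close> is the scaling that leaves linear functions unchanged;
  second derivatives keep one factor \<open>\<rho>\<close>, so the right-hand side tends to 0 under
  blow-up.\<close>

lemma cone_sub_scale:
  fixes v :: "real^'n \<Rightarrow> real"
  assumes cone: "open_cone \<Omega>" and \<rho>: "\<rho> > 0" and v: "cone_sub \<Omega> C v"
  shows "cone_sub \<Omega> (\<rho> * C) (\<lambda>x. v (\<rho> *\<^sub>R x) / \<rho>)"
  unfolding cone_sub_def
proof (intro conjI ballI)
  have op: "open \<Omega>" using cone by (simp add: open_cone_def)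
  show "continuous_on (closure \<Omega> - {0}) (\<lambda>x. v (\<rho> *\<^sub>R x) / \<rho>)"
  proof -
    have "continuous_on (closure \<Omega> - {0}) v" using v unfolding cone_sub_def by blast
    then have "continuous_on (closure \<Omega> - {0}) (\<lambda>x. v (\<rho> *\<^sub>R x))"
    proof (rule continuous_on_compose2)
      show "continuous_on (closure \<Omega> - {0}) (\<lambda>x. \<rho> *\<^sub>R x)" by (intro continuous_intros)
    qed (use \<rho> open_cone_closure_scale[OF cone \<rho>] in auto)
    then show ?thesis by (rule continuous_on_divide) (use \<rho> in auto)
  qed
  show "v (\<rho> *\<^sub>R p) / \<rho> \<le> 0" if "p \<in> frontier \<Omega> - {0}" for p
  proof -
    have "\<rho> *\<^sub>R p \<in> frontier \<Omega> - {0}"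
      using that \<rho> op open_cone_closure_scale[OF cone \<rho>] open_cone_scale[OF cone \<rho>]
      by (auto simp: frontier_def interior_open)
    then show ?thesis using v \<rho> unfolding cone_sub_def by (simp add: divide_le_0_iff)
  qed
  show "visc_sub \<Omega> (\<rho> * C) (\<lambda>x. v (\<rho> *\<^sub>R x) / \<rho>)"
    unfolding visc_sub_def
  proof (intro ballI allI impI)
    fix x0 r z
    assume x0: "x0 \<in> \<Omega>" and r: "(r::real) > 0" and sub: "ball x0 r \<subseteq> \<Omega>"
      and cz: "continuous_on (ball x0 r) z"
      and lap: "\<forall>x\<in>ball x0 r. \<exists>d l. has_lap z x d l \<and> l \<le> - (\<rho> * C)"
    have vis: "visc_sub \<Omega> C v" using v by (simp add: cone_sub_def)
    \<comment> \<open>The inverse rescaling carries a test function for the dilated function to one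
      for \<open>v\<close>; its Laplacian gets divided by \<open>\<rho>\<close>.\<close>
    let ?z = "\<lambda>y. \<rho> * z (inverse \<rho> *\<^sub>R y)"
    have inb: "inverse \<rho> *\<^sub>R y \<in> ball x0 r" if "y \<in> ball (\<rho> *\<^sub>R x0) (\<rho> * r)" for y
    proof -
      have "x0 - inverse \<rho> *\<^sub>R y = inverse \<rho> *\<^sub>R (\<rho> *\<^sub>R x0 - y)"
        using \<rho> by (simp add: algebra_simps)
      then have "norm (x0 - inverse \<rho> *\<^sub>R y) = inverse \<rho> * norm (\<rho> *\<^sub>R x0 - y)"
        using \<rho> by simp
      also have "\<dots> < inverse \<rho> * (\<rho> * r)"
        using that \<rho> by (intro mult_strict_left_mono) (auto simp: dist_norm)
      also have "\<dots> = r" using \<rho> by simp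
      finally show ?thesis by (simp add: dist_norm)
    qed
    have "\<exists>y\<in>ball (\<rho> *\<^sub>R x0) (\<rho> * r). v y - ?z y > v (\<rho> *\<^sub>R x0) - ?z (\<rho> *\<^sub>R x0)"
    proof (rule visc_subD[OF vis, where z = ?z])
      show "\<rho> *\<^sub>R x0 \<in> \<Omega>" using x0 open_cone_scale[OF cone \<rho>] by simp
      show "0 < \<rho> * r" using \<rho> r by simp
      show "ball (\<rho> *\<^sub>R x0) (\<rho> * r) \<subseteq> \<Omega>"
      proof
        fix y assume "y \<in> ball (\<rho> *\<^sub>R x0) (\<rho> * r)"
        then have "inverse \<rho> *\<^sub>R y \<in> \<Omega>" using inb sub by blast
        then show "y \<in> \<Omega>" using open_cone_scale[OF cone, of "inverse \<rho>" y] \<rho> by simp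
      qed
      show "continuous_on (ball (\<rho> *\<^sub>R x0) (\<rho> * r)) ?z"
      proof (rule continuous_on_mult_left, rule continuous_on_compose2[OF cz])
        show "continuous_on (ball (\<rho> *\<^sub>R x0) (\<rho> * r)) (\<lambda>y. inverse \<rho> *\<^sub>R y)"
          by (intro continuous_intros)
      qed (use inb in blast)
      show "\<exists>d l. has_lap ?z y d l \<and> l \<le> - C" if yb: "y \<in> ball (\<rho> *\<^sub>R x0) (\<rho> * r)" for y
      proof -
        obtain d l where l: "has_lap z (inverse \<rho> *\<^sub>R y) d l" "l \<le> - (\<rho> * C)"
          using lap inb[OF yb] by blast
        have "\<rho> * ((inverse \<rho>)\<^sup>2 * l) \<le> - C"
          using l(2) \<rho> by (simp add: power2_eq_square field_simps)
        with has_lap_cmult[OF has_lap_scale[OF l(1)], of \<rho>] show ?thesis by blast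
      qed
    qed
    then obtain y where y: "y \<in> ball (\<rho> *\<^sub>R x0) (\<rho> * r)"
      "v y - ?z y > v (\<rho> *\<^sub>R x0) - ?z (\<rho> *\<^sub>R x0)" by blast
    show "\<exists>x\<in>ball x0 r. v (\<rho> *\<^sub>R x) / \<rho> - z x > v (\<rho> *\<^sub>R x0) / \<rho> - z x0"
    proof (rule bexI[OF _ inb[OF y(1)]])
      have "(v (\<rho> *\<^sub>R x0) - ?z (\<rho> *\<^sub>R x0)) / \<rho> < (v y - ?z y) / \<rho>"
        using y(2) \<rho> by (rule divide_strict_right_mono)
      then show "v (\<rho> *\<^sub>R x0) / \<rho> - z x0 < v (\<rho> *\<^sub>R inverse \<rho> *\<^sub>R y) / \<rho> - z (inverse \<rho> *\<^sub>R y)"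
        using \<rho> by (simp add: diff_divide_distrib)
    qed
  qed
qed

lemma frontier_Int_ball_cases:
  fixes y :: "'a::metric_space"
  assumes "open \<Omega>" "y \<in> frontier (\<Omega> \<inter> ball a s)"
  shows "y \<in> closure \<Omega>" "dist a y \<le> s" "y \<in> frontier \<Omega> \<or> y \<in> \<Omega> \<and> dist a y = s"
proof -
  have y: "y \<in> closure (\<Omega> \<inter> ball a s)" "y \<notin> \<Omega> \<inter> ball a s"
    using assms by (auto simp: frontier_def interior_open)
  then show c: "y \<in> closure \<Omega>" using closure_mono[of "\<Omega> \<inter> ball a s" \<Omega>] by blast
  have "y \<in> closure (ball a s)" using y(1) closure_mono[of "\<Omega> \<inter> ball a s" "ball a s"] by blast
  then have "y \<in> cball a s" using closure_minimal[OF ball_subset_cball closed_cball] by blast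
  then show d: "dist a y \<le> s" by simp
  show "y \<in> frontier \<Omega> \<or> y \<in> \<Omega> \<and> dist a y = s"
    using c d y(2) assms(1) by (auto simp: frontier_def interior_open)
qed

lemma closure_half_space:
  assumes "\<Omega> \<subseteq> {x::real^'n. x $ k > 0}" "x \<in> closure \<Omega>"
  shows "x $ k \<ge> 0"
proof -
  have "closed {x::real^'n. x $ k \<ge> 0}"
    using closed_halfspace_component_ge_cart[of 0 k] by simp
  then have "closure \<Omega> \<subseteq> {x. x $ k \<ge> 0}"
    by (intro closure_minimal) (use assms in auto)
  then show ?thesis using assms(2) by blast
qed

section \<open>Decay at the vertex\<close>

text \<open>If x_k is comparable to |x|, the bound \<open>M\<close> suffices. Otherwise compare on a
  ball of radius |x|/4 about the projection \<open>a\<close> of \<open>x\<close> to the hyperplane;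
  this ball stays away from the vertex, so no information there is required.\<close>

lemma cone_sub_bound_div_norm:
  fixes v :: "real^'n \<Rightarrow> real" and C M :: real
  assumes op: "open \<Omega>" and half: "\<Omega> \<subseteq> {x. x $ k > 0}" and v: "cone_sub \<Omega> C v"
    and C: "C \<ge> 0" and M: "M \<ge> 0" "\<And>x. x \<in> \<Omega> \<Longrightarrow> v x \<le> M"
    and x: "x \<in> \<Omega>" "norm x \<le> 1"
  shows "v x \<le> (4 * M + 8 * (CARD('n) * M + C)) * x $ k / norm x"
proof -
  let ?K = "4 * M + 8 * (CARD('n) * M + C)"
  have xk: "x $ k > 0" using half x by auto
  then have x0: "norm x > 0" by auto
  show ?thesis
  proof (cases "x $ k \<ge> norm x / 4")
    case True
    have "M * norm x \<le> M * (4 * x $ k)" using True M by (intro mult_left_mono) auto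
    also have "\<dots> \<le> ?K * x $ k" using C M xk by (simp add: algebra_simps)
    finally have "M \<le> ?K * x $ k / norm x" using x0 by (simp add: field_simps)
    then show ?thesis using M(2)[OF x(1)] by linarith
  next
    case False
    define \<sigma> where "\<sigma> = norm x / 4"
    have \<sigma>: "\<sigma> > 0" "\<sigma> \<le> 1" "x $ k < \<sigma>" using x0 x False by (auto simp: \<sigma>_def)
    define a where "a = x - x $ k *\<^sub>R axis k 1"
    have ak: "a $ k = 0" by (simp add: a_def)
    have xa: "norm (x - a) = x $ k" using xk by (simp add: a_def)
    have na: "norm a > \<sigma>"
    proof -
      have "norm x \<le> norm a + norm (x - a)" using norm_triangle_ineq[of a "x - a"] by simp
      then show ?thesis using \<sigma>(3) xa x0 unfolding \<sigma>_def by linarith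
    qed
    define D where "D = \<Omega> \<inter> ball a \<sigma>"
    \<comment> \<open>Makes the quadratic outweigh both the Laplacian 2nM/\<sigma>^2 of the first
      term of \<open>z\<close> and the right-hand side \<open>C\<close>.\<close>
    define N where "N = (CARD('n) * M + C) / \<sigma>\<^sup>2"
    have N: "N \<ge> 0" using M C by (simp add: N_def)
    define z where "z = (\<lambda>y::real^'n. M / \<sigma>\<^sup>2 * (norm (y - a))\<^sup>2 + N * (2 * \<sigma> * y $ k - (y $ k)\<^sup>2))"
    have quad: "2 * \<sigma> * y $ k - (y $ k)\<^sup>2 \<ge> 0" if "y \<in> closure \<Omega>" "dist a y \<le> \<sigma>" for y
    proof -
      have "y $ k \<ge> 0" using closure_half_space[OF half that(1)] .
      moreover have "y $ k \<le> \<sigma>"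
        using component_le_norm_cart[of "y - a" k] that(2) ak by (simp add: dist_norm norm_minus_commute)
      ultimately have "y $ k * (2 * \<sigma> - y $ k) \<ge> 0" by (intro mult_nonneg_nonneg) auto
      then show ?thesis by (simp add: power2_eq_square algebra_simps)
    qed
    have "v x \<le> z x"
    proof (rule visc_comparison[where D = D and \<Omega> = \<Omega> and C = C])
      show "open D" "bounded D" "D \<subseteq> \<Omega>" using op by (auto simp: D_def bounded_Int)
      show "visc_sub \<Omega> C v" "continuous_on (closure \<Omega> - {0}) v" using v by (auto simp: cone_sub_def)
      show "continuous_on (closure D - {0}) z" unfolding z_def by (intro continuous_intros)
      show "0 \<notin> D" using half by (auto simp: D_def)
      show "x \<in> D" using x xa \<sigma> by (simp add: D_def dist_norm norm_minus_commute)
      show "\<exists>r>0. \<forall>y\<in>D. norm y < r \<longrightarrow> v y - z y \<le> \<delta>" for \<delta>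
      proof (intro exI[of _ "norm a - \<sigma>"] conjI ballI impI)
        fix y assume "y \<in> D" "norm y < norm a - \<sigma>"
        then show "v y - z y \<le> \<delta>"
          using norm_triangle_ineq2[of a y] by (auto simp: D_def dist_norm)
      qed (use na in simp)
      show "\<exists>d l. has_lap z y d l \<and> l \<le> - C" for y
      proof -
        obtain d where d: "has_lap (\<lambda>x. 2 * \<sigma> * x $ k - (x $ k)\<^sup>2) y d (-2)"
          using has_lap_coord_quadratic by blast
        have "has_lap z y ((M / \<sigma>\<^sup>2) *\<^sub>R 2 *\<^sub>R (y - a) + N *\<^sub>R d) (M / \<sigma>\<^sup>2 * (2 * CARD('n)) + N * (-2))"
          unfolding z_def by (intro has_lap_add has_lap_cmult has_lap_sqdist d)
        moreover have "M / \<sigma>\<^sup>2 * (2 * CARD('n)) + N * (-2) = - 2 * (C / \<sigma>\<^sup>2)"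
          using \<sigma> by (simp add: N_def field_simps)
        moreover have "C \<le> C / \<sigma>\<^sup>2"
          using \<sigma> C by (simp add: pos_le_divide_eq mult_left_le power_le_one)
        ultimately show ?thesis using C by (intro exI conjI) (assumption, simp)
      qed
      show "v y \<le> z y" if "y \<in> frontier D" "y \<noteq> 0" for y
      proof -
        note fr = frontier_Int_ball_cases[OF op, of y a \<sigma>, folded D_def, OF that(1)]
        have N0: "N * (2 * \<sigma> * y $ k - (y $ k)\<^sup>2) \<ge> 0" using N quad[OF fr(1,2)] by simp
        from fr(3) show ?thesis
        proof
          assume "y \<in> frontier \<Omega>"
          then have "v y \<le> 0" using v that(2) by (auto simp: cone_sub_def)
          moreover have "z y \<ge> 0" using N0 M by (simp add: z_def)
          ultimately show ?thesis by simp
        next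
          assume "y \<in> \<Omega> \<and> dist a y = \<sigma>"
          then have "v y \<le> M" "M / \<sigma>\<^sup>2 * (norm (y - a))\<^sup>2 = M"
            using M \<sigma> by (auto simp: dist_norm norm_minus_commute)
          then show ?thesis using N0 by (simp add: z_def)
        qed
      qed
    qed
    also have "z x \<le> M / \<sigma>\<^sup>2 * (\<sigma> * x $ k) + N * (2 * \<sigma> * x $ k)"
    proof (unfold z_def xa, intro add_mono mult_left_mono)
      show "(x $ k)\<^sup>2 \<le> \<sigma> * x $ k" using xk \<sigma> by (simp add: power2_eq_square)
    qed (use M N in auto)
    also have "\<dots> = (M + 2 * (CARD('n) * M + C)) * x $ k / \<sigma>"
      using \<sigma>(1) by (simp add: N_def field_simps power2_eq_square)
    also have "\<dots> = ?K * x $ k / norm x" by (simp add: \<sigma>_def field_simps)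
    finally show ?thesis .
  qed
qed

text \<open>The function \<open>x\<^sub>k |x| powr (-3/2)\<close> is superharmonic since \<open>3/2 < n\<close>, and it dominates
  \<open>x\<^sub>k / |x|\<close> at the origin. It removes the singularity at the vertex in \<open>cone_sub_bound_linear\<close>.\<close>

lemma has_lap_coord_powr:
  fixes x :: "real^'n"
  assumes n: "CARD('n) \<ge> 2" and x: "x $ k > 0"
  shows "\<exists>d l. has_lap (\<lambda>x. x $ k * ((norm (x - 0))\<^sup>2 powr (-3/4))) x d l \<and> l \<le> 0"
proof -
  define t where "t = (norm (x - 0))\<^sup>2"
  have "x \<noteq> 0" using x by auto
  then have t: "t > 0" by (simp add: t_def)
  have F: "\<forall>\<^sub>F y in nhds t. ((\<lambda>y. y powr (-3/4)) has_real_derivative (-3/4) * y powr (-7/4)) (at y)"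
  proof -
    have "\<forall>\<^sub>F y in nhds t. y \<in> {0<..}" using t by (intro eventually_nhds_in_open) auto
    then show ?thesis 
    proof eventually_elim
      case (elim y)
      then show ?case by (intro DERIV_cong[OF has_real_derivative_powr]) auto
    qed
  qed
  have F': "((\<lambda>y. (-3/4) * y powr (-7/4)) has_real_derivative (21/16) * t powr (-11/4)) (at t)"
    by (rule DERIV_cong[OF DERIV_cmult[OF has_real_derivative_powr[OF t]]]) simp
  have L: "has_lap (\<lambda>x. (norm (x - 0))\<^sup>2 powr (-3/4)) x (((-3/4) * t powr (-7/4)) *\<^sub>R 2 *\<^sub>R (x - 0))
      (21/16 * t powr (-11/4) * (norm (2 *\<^sub>R (x - 0)))\<^sup>2 + (-3/4) * t powr (-7/4) * (2 * CARD('n)))"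
    using has_lap_compose[where F = "\<lambda>y. y powr (-3/4)" and F' = "\<lambda>y. (-3/4) * y powr (-7/4)",
        OF has_lap_sqdist[of 0 x]] F F' unfolding t_def by blast
  have "(norm (2 *\<^sub>R (x - 0)))\<^sup>2 = 4 * t" by (simp add: t_def power_mult_distrib)
  moreover have tt: "t powr (-11/4) * t = t powr (-7/4)"
    using t powr_add[of t "-11/4" 1] by simp
  ultimately have e: "21/16 * t powr (-11/4) * (norm (2 *\<^sub>R (x - 0)))\<^sup>2 +
      (-3/4) * t powr (-7/4) * (2 * CARD('n)) = (21/4 - 3/2 * CARD('n)) * t powr (-7/4)"
    by (simp add: algebra_simps)
  have ip: "axis k 1 \<bullet> ((-3/4 * t powr (-7/4)) *\<^sub>R 2 *\<^sub>R (x - 0)) = - (3/2) * t powr (-7/4) * x $ k"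
    by (simp add: inner_axis')
  define l where "l = 0 * ((norm (x - 0))\<^sup>2 powr (-3/4)) + 2 * (- (3/2) * t powr (-7/4) * x $ k)
        + x $ k * ((21/4 - 3/2 * CARD('n)) * t powr (-7/4))"
  \<comment> \<open>In general x_k |x|^-a has Laplacian a (a - n) x_k |x|^(-a-2); here a =
    3/2.\<close>
  have "l = (9/4 - 3/2 * CARD('n)) * (x $ k * t powr (-7/4))"
    unfolding l_def by (simp add: algebra_simps)
  moreover have "(9/4 - 3/2 * CARD('n)) * (x $ k * t powr (-7/4)) \<le> 0"
    using n x by (intro mult_nonpos_nonneg) auto
  ultimately have "l \<le> 0" by linarith
  then show ?thesis
    using has_lap_mult[OF has_lap_coord L, of k] unfolding e ip l_def[symmetric] by blast
qed

lemma power2_powr_minus: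
  fixes t :: real
  assumes t: "t > 0"
  shows "t\<^sup>2 powr (-3/4) = inverse (t * sqrt t)"
proof -
  have "t\<^sup>2 powr (-3/4) = t powr (-3/2)"
    using t powr_powr[of "t" 2 "-3/4"] by simp
  also have "\<dots> = t powr (-1) * t powr (-1/2)"
    using powr_add[of "t" "-1" "-1/2"] by simp
  also have "\<dots> = inverse (t * sqrt t)"
    using t by (simp add: powr_minus powr_half_sqrt)
  finally show ?thesis .
qed

text \<open>The bound K x_k / |x| is too weak at the vertex for comparison with a linear function,
  but it is of lower order than \<open>p\<close>. An arbitrarily small multiple of \<open>p\<close>
  repairs the comparison, and letting it tend to 0 leaves only linear terms. On the unit sphere the
  assumed bound is already linear.\<close>

lemma cone_sub_bound_linear:
  fixes v :: "real^'n \<Rightarrow> real" and C K :: real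
  assumes n: "CARD('n) \<ge> 2"
    and op: "open \<Omega>" and half: "\<Omega> \<subseteq> {x. x $ k > 0}" and v: "cone_sub \<Omega> C v"
    and C: "C \<ge> 0" and K: "K \<ge> 0" "\<And>x. x \<in> \<Omega> \<Longrightarrow> norm x \<le> 1 \<Longrightarrow> v x \<le> K * x $ k / norm x"
    and x: "x \<in> \<Omega>" "norm x < 1"
  shows "v x \<le> (K + 2 * C) * x $ k"
proof (rule field_le_epsilon)
  fix \<epsilon> :: real assume \<epsilon>: "\<epsilon> > 0"
  define p where "p = (\<lambda>y::real^'n. y $ k * ((norm (y - 0))\<^sup>2 powr (-3/4)))"
  have p: "p y = y $ k / (norm y * sqrt (norm y))" if "y \<noteq> 0" for y
  proof -
    have "(norm y)\<^sup>2 powr (-3/4) = inverse (norm y * sqrt (norm y))"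
      using that by (intro power2_powr_minus) simp
    then show ?thesis unfolding p_def by (simp only: diff_zero divide_inverse)
  qed
  have xk: "x $ k > 0" using half x by auto
  then have x0: "x \<noteq> 0" by auto
  have px: "p x > 0" using p[OF x0] xk x0 by simp
  \<comment> \<open>With \<open>x\<close> fixed, the correction contributes exactly
    \<open>\<epsilon>\<close> at \<open>x\<close>.\<close>
  define \<eta> where "\<eta> = \<epsilon> / p x"
  have \<eta>: "\<eta> > 0" using \<epsilon> px by (simp add: \<eta>_def)
  define z where "z = (\<lambda>y::real^'n. K * y $ k + \<eta> * p y + C * (2 * 1 * y $ k - (y $ k)\<^sup>2))"
  define D where "D = \<Omega> \<inter> ball 0 1"
  have quad: "y $ k \<ge> 0 \<and> p y \<ge> 0 \<and> C * (2 * 1 * y $ k - (y $ k)\<^sup>2) \<ge> 0"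
    if "y \<in> closure \<Omega>" "norm y \<le> 1" for y
  proof -
    have yk: "y $ k \<ge> 0" using closure_half_space[OF half that(1)] .
    moreover have "y $ k \<le> 1" using component_le_norm_cart[of y k] that(2) by simp
    ultimately have "C * (y $ k * (2 - y $ k)) \<ge> 0" using C by (intro mult_nonneg_nonneg) auto
    then show ?thesis using yk by (simp add: power2_eq_square algebra_simps p_def)
  qed
  have "v x \<le> z x"
  proof (rule visc_comparison[where D = D and \<Omega> = \<Omega> and C = C])
    show "open D" "bounded D" "D \<subseteq> \<Omega>" using op by (auto simp: D_def bounded_Int)
    show "visc_sub \<Omega> C v" "continuous_on (closure \<Omega> - {0}) v" using v by (auto simp: cone_sub_def)
    show "continuous_on (closure D - {0}) z" unfolding z_def p_def by (intro continuous_intros) auto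
    show "0 \<notin> D" using half by (auto simp: D_def)
    show "x \<in> D" using x by (simp add: D_def)
    show "\<exists>r>0. \<forall>y\<in>D. norm y < r \<longrightarrow> v y - z y \<le> \<delta>" if "\<delta> > 0" for \<delta>
    \<comment> \<open>The inequality K y_k / |y| <= \<open>\<eta> * p y\<close> amounts to K sqrt
      |y| <= \<open>\<eta>\<close>, which holds in this ball; K + 1 avoids a division by 0.\<close>
    proof (intro exI[of _ "(\<eta> / (K + 1))\<^sup>2"] conjI ballI impI)
      fix y assume y: "y \<in> D" "norm y < (\<eta> / (K + 1))\<^sup>2"
      then have y': "y \<in> \<Omega>" "norm y \<le> 1" "y $ k > 0" using half by (auto simp: D_def)
      then have ny: "norm y > 0" by auto
      have "sqrt (norm y) < \<eta> / (K + 1)" using y(2) \<eta> K by (intro real_less_lsqrt) auto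
      then have "sqrt (norm y) * (K + 1) < \<eta>" using K by (simp add: pos_less_divide_eq)
      moreover have "sqrt (norm y) * (K + 1) = K * sqrt (norm y) + sqrt (norm y)"
        by (simp add: algebra_simps)
      moreover have "sqrt (norm y) \<ge> 0" by simp
      ultimately have "K * sqrt (norm y) \<le> \<eta>" by linarith
      then have "K * (y $ k / norm y) \<le> \<eta> / sqrt (norm y) * (y $ k / norm y)"
        using ny y'(3) by (intro mult_right_mono) (auto simp: field_simps)
      also have "\<dots> = \<eta> * p y" using p[of y] ny by (simp add: field_simps)
      finally have "v y \<le> \<eta> * p y" using K(2)[OF y'(1,2)] by simp
      moreover have "\<eta> * p y \<le> z y"
        using quad[of y] y' closure_subset[of \<Omega>] K by (auto simp: z_def subset_iff)
      ultimately show "v y - z y \<le> \<delta>" using that by simp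
    qed (use \<eta> K in auto)
    show "\<exists>d l. has_lap z y d l \<and> l \<le> - C" if "y \<in> D" for y
    proof -
      have yk: "y $ k > 0" using that half by (auto simp: D_def)
      obtain d where d: "has_lap (\<lambda>x. 2 * 1 * x $ k - (x $ k)\<^sup>2) y d (-2)"
        using has_lap_coord_quadratic by blast
      obtain e l where e: "has_lap p y e l" "l \<le> 0"
        using has_lap_coord_powr[OF n yk] unfolding p_def by blast
      have "has_lap z y (K *\<^sub>R axis k 1 + \<eta> *\<^sub>R e + C *\<^sub>R d) (K * 0 + \<eta> * l + C * (-2))"
        unfolding z_def by (intro has_lap_add has_lap_cmult has_lap_coord d e)
      moreover have "\<eta> * l \<le> 0" using \<eta> e by (simp add: mult_nonneg_nonpos)
      ultimately show ?thesis using C by (intro exI conjI) (assumption, simp)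
    qed
    show "v y \<le> z y" if "y \<in> frontier D" "y \<noteq> 0" for y
    proof -
      note fr = frontier_Int_ball_cases[OF op, of y 0 1, folded D_def, OF that(1)]
      have q: "y $ k \<ge> 0" "p y \<ge> 0" "C * (2 * 1 * y $ k - (y $ k)\<^sup>2) \<ge> 0"
        using quad[of y] fr by auto
      have qq: "z y \<ge> K * y $ k" "K * y $ k \<ge> 0" using q \<eta> K by (auto simp: z_def)
      from fr(3) show ?thesis
      proof
        assume "y \<in> frontier \<Omega>"
        then have "v y \<le> 0" using v that(2) by (auto simp: cone_sub_def)
        then show ?thesis using qq by simp
      next
        assume "y \<in> \<Omega> \<and> dist 0 y = 1"
        then show ?thesis using qq K(2)[of y] by simp
      qed
    qed
  qed
  also have "z x \<le> (K + 2 * C) * x $ k + \<epsilon>"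
    using px C by (simp add: z_def \<eta>_def algebra_simps)
  finally show "v x \<le> (K + 2 * C) * x $ k + \<epsilon>" .
qed

text \<open>The barrier is \<open>m x\<^sub>k\<close> minus a multiple of \<open>G = |x - q|\<^bsup>-2N\<^esup> - |x - q'|\<^bsup>-2N\<^esup>\<close>, where \<open>q'\<close>
  is the reflection of \<open>q\<close>. With \<open>N = n\<close>, \<open>G\<close> is subharmonic, vanishes on the hyperplane, and
  is at least twice as large relative to \<open>x\<^sub>k\<close> on the unit ball as on the sphere of radius \<open>R\<close>.\<close>

lemma cone_sub_flatten_step:
  fixes q :: "real^'n"
  assumes op: "open \<Omega>" and half: "\<Omega> \<subseteq> {x. x $ k > 0}"
    and qk: "q $ k > 0" and e: "e > 0" and away: "ball q e \<inter> \<Omega> = {}"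
  obtains R \<theta> :: real where "R > 1" "0 \<le> \<theta>" "\<theta> < 1"
    and "\<And>C v m x. \<lbrakk>C \<ge> 0; m \<ge> 0; cone_sub \<Omega> C v;
           \<And>x. x \<in> \<Omega> \<Longrightarrow> norm x \<le> R \<Longrightarrow> v x \<le> m * x $ k;
           x \<in> \<Omega>; norm x \<le> 1\<rbrakk> \<Longrightarrow> v x \<le> (\<theta> * m + 2 * R * C) * x $ k"
proof -
  define N where "N = CARD('n)"
  have N: "N > 0" by (simp add: N_def)
  \<comment> \<open>\<open>s\<close> bounds the distance from points of the unit ball to
    \<open>q'\<close>, and on the sphere of radius \<open>R\<close> the distance to \<open>q\<close>
    is at least \<open>2 * s\<close>. This doubling is the source of the gain.\<close>
  define s where "s = 1 + norm q"
  have s: "s \<ge> 1" by (simp add: s_def)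
  define R where "R = norm q + 2 * s"
  define q' where "q' = q - (2 * q $ k) *\<^sub>R axis k 1"
  define a b where "a = (\<lambda>y. (norm (y - q))\<^sup>2)" and "b = (\<lambda>y. (norm (y - q'))\<^sup>2)"
  define G where "G = (\<lambda>y. inverse (a y) ^ N - inverse (b y) ^ N)"
  have ab: "b y = a y + 4 * q $ k * y $ k" for y
  proof -
    have *: "y - q' = (y - q) + (2 * q $ k) *\<^sub>R axis k 1" by (simp add: q'_def)
    show ?thesis unfolding a_def b_def * power2_norm_eq_inner
      by (simp add: inner_add_left inner_add_right inner_axis inner_axis' algebra_simps)
  qed
  have nq: "norm q' = norm q" using ab[of 0] by (simp add: a_def b_def)
  have clo: "y $ k \<ge> 0 \<and> a y \<ge> e\<^sup>2" if "y \<in> closure \<Omega>" for y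
  proof
    show "y $ k \<ge> 0" using closure_half_space[OF half that] .
    have "ball q e \<inter> closure \<Omega> = {}"
      using away open_Int_closure_eq_empty[OF open_ball] by blast
    then have "y \<notin> ball q e" using that by blast
    then have "norm (y - q) \<ge> e" by (simp add: dist_norm norm_minus_commute)
    then show "a y \<ge> e\<^sup>2" unfolding a_def using e by (intro power_mono) auto
  qed
  have a0: "a y > 0" if "y \<in> closure \<Omega>" for y
    using clo[OF that] e by (smt (verit) zero_less_power)
  have ab': "a y \<le> b y" if "y \<in> closure \<Omega>" for y
    using clo[OF that] qk by (simp add: ab)
  \<comment> \<open>As b - a = 4 q_k y_k, the mean value bounds compare G / y_k with 4 N q_k
    t^(-2N-2), where \<open>t\<close> is a lower bound for the distance to \<open>q\<close> in the
    upper estimate and an upper bound for the distance to \<open>q'\<close> in the lower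
    one.\<close>
  define \<kappa>f where "\<kappa>f = (\<lambda>t. 4 * N * q $ k * inverse (t\<^sup>2) ^ (N + 1))"
  have \<kappa>f: "\<kappa>f t > 0" if "t > 0" for t using that N qk by (simp add: \<kappa>f_def)
  have G_upper: "G y \<le> \<kappa>f t * y $ k" if y: "y \<in> closure \<Omega>" and t: "t > 0" "a y \<ge> t\<^sup>2" for y t
  proof -
    have "G y \<le> N * (b y - a y) * inverse (a y) ^ (N + 1)"
      unfolding G_def by (rule inv_pow_diff_bounds(2)[OF a0[OF y] ab'[OF y]])
    also have "\<dots> \<le> N * (b y - a y) * inverse (t\<^sup>2) ^ (N + 1)"
      using t ab'[OF y] a0[OF y] by (intro mult_left_mono power_mono le_imp_inverse_le) auto
    finally show ?thesis by (simp add: \<kappa>f_def ab mult_ac)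
  qed
  have G_lower: "\<kappa>f s * y $ k \<le> G y" if y: "y \<in> closure \<Omega>" "norm y \<le> 1" for y
  proof -
    have "norm (y - q') \<le> s" using norm_triangle_ineq4[of y q'] nq y(2) by (simp add: s_def)
    then have "b y \<le> s\<^sup>2" unfolding b_def by (intro power_mono) auto
    then have "N * (b y - a y) * inverse (s\<^sup>2) ^ (N + 1) \<le> N * (b y - a y) * inverse (b y) ^ (N + 1)"
      using a0[OF y(1)] ab'[OF y(1)] by (intro mult_left_mono power_mono le_imp_inverse_le) auto
    also have "\<dots> \<le> G y"
      unfolding G_def by (rule inv_pow_diff_bounds(1)[OF a0[OF y(1)] ab'[OF y(1)]])
    finally show ?thesis by (simp add: \<kappa>f_def ab mult_ac)
  qed
  define \<kappa> where "\<kappa> = \<kappa>f (2 * s)"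
  have \<kappa>: "\<kappa> > 0" unfolding \<kappa>_def using s by (intro \<kappa>f) auto
  \<comment> \<open>Doubling the distance costs the factor 1/4 to the power N + 1, which is below
    1/2.\<close>
  have "\<kappa> = inverse 4 ^ (N + 1) * \<kappa>f s"
  proof -
    have "inverse ((2 * s)\<^sup>2) = inverse 4 * inverse (s\<^sup>2)" by (simp add: power_mult_distrib)
    then show ?thesis unfolding \<kappa>_def \<kappa>f_def by (simp only: power_mult_distrib mult_ac)
  qed
  moreover have "inverse 4 ^ (N + 1) \<le> (1/2 :: real)"
    using power_le_one[of "1/4::real" N] by (simp add: inverse_eq_divide)
  ultimately have "\<kappa> \<le> 1/2 * \<kappa>f s"
    using mult_right_mono[of "inverse 4 ^ (N + 1)" "1/2" "\<kappa>f s"] \<kappa>f[of s] s by linarith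
  then have \<kappa>2: "2 * \<kappa> \<le> \<kappa>f s" by simp
  define \<kappa>0 where "\<kappa>0 = \<kappa>f e"
  have \<kappa>0: "\<kappa>0 > 0" unfolding \<kappa>0_def using e by (rule \<kappa>f)
  \<comment> \<open>\<open>\<kappa>0\<close> bounds G / y_k on the whole closed cone, so
    \<open>\<epsilon> * \<kappa>0 \<le> 1\<close> keeps the barrier nonnegative;
    \<open>\<epsilon> * \<kappa> \<le> 1\<close> keeps \<open>\<theta>\<close> nonnegative.\<close>
  define \<epsilon> where "\<epsilon> = 1 / (\<kappa>0 + \<kappa>)"
  have \<epsilon>: "\<epsilon> > 0" "\<epsilon> * \<kappa>0 \<le> 1" "\<epsilon> * \<kappa> \<le> 1" using \<kappa> \<kappa>0 by (auto simp: \<epsilon>_def field_simps)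
  define \<theta> where "\<theta> = 1 - \<epsilon> * \<kappa>"
  have step: "v x \<le> (\<theta> * m + 2 * R * C) * x $ k"
    if C: "C \<ge> 0" and m: "m \<ge> 0" and v: "cone_sub \<Omega> C v"
      and vm: "\<And>x. x \<in> \<Omega> \<Longrightarrow> norm x \<le> R \<Longrightarrow> v x \<le> m * x $ k"
      and x: "x \<in> \<Omega>" "norm x \<le> 1" for C v m x
  proof -
    have R: "R > 1" using s norm_ge_zero[of q] unfolding R_def by linarith
    define D where "D = \<Omega> \<inter> ball 0 R"
    \<comment> \<open>The coefficient (1 + \<epsilon> \<kappa>) m makes \<open>z\<close> at least m
      y_k on the outer sphere, where G <= \<kappa> y_k. On the unit ball G >= 2 \<kappa> y_k lowers
      the slope to (1 - \<epsilon> \<kappa>) m, up to the \<open>C\<close> term.\<close>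
    define z where "z = (\<lambda>y::real^'n. (1 + \<epsilon> * \<kappa>) * m * y $ k - \<epsilon> * m * G y + C * (2 * R * y $ k - (y $ k)\<^sup>2))"
    have quad: "C * (2 * R * y $ k - (y $ k)\<^sup>2) \<ge> 0" if "y \<in> closure \<Omega>" "norm y \<le> R" for y
    proof -
      have "y $ k \<ge> 0" using clo[OF that(1)] by blast
      moreover have "y $ k \<le> R" using component_le_norm_cart[of y k] that(2) by simp
      ultimately have "C * (y $ k * (2 * R - y $ k)) \<ge> 0" using C by (intro mult_nonneg_nonneg) auto
      then show ?thesis by (simp add: power2_eq_square algebra_simps)
    qed
    have z0: "z y \<ge> 0" if y: "y \<in> closure \<Omega>" "norm y \<le> R" for y
    proof -
      have "G y \<le> \<kappa>0 * y $ k" unfolding \<kappa>0_def using clo[OF y(1)] e by (intro G_upper y) auto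
      then have "\<epsilon> * m * G y \<le> \<epsilon> * m * (\<kappa>0 * y $ k)" using \<epsilon> m by (intro mult_left_mono) auto
      also have "\<dots> = (\<epsilon> * \<kappa>0) * (m * y $ k)" by simp
      also have "\<dots> \<le> (1 + \<epsilon> * \<kappa>) * (m * y $ k)"
        using \<epsilon> \<kappa> m clo[OF y(1)] by (intro mult_right_mono) (auto intro: order_trans)
      finally show ?thesis using quad[OF y] by (simp add: z_def mult_ac)
    qed
    have "v x \<le> z x"
    proof (rule visc_comparison[where D = D and \<Omega> = \<Omega> and C = C])
      show "open D" "bounded D" "D \<subseteq> \<Omega>" using op by (auto simp: D_def bounded_Int)
      show "visc_sub \<Omega> C v" "continuous_on (closure \<Omega> - {0}) v" using v by (auto simp: cone_sub_def)
      have "closure D \<subseteq> closure \<Omega>" by (intro closure_mono) (simp add: D_def)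
      then have "a y \<noteq> 0 \<and> b y \<noteq> 0" if "y \<in> closure D" for y
        using a0[of y] ab'[of y] that by auto
      then show "continuous_on (closure D - {0}) z"
        unfolding z_def G_def a_def b_def by (intro continuous_intros) auto
      show "0 \<notin> D" using half by (auto simp: D_def)
      show "x \<in> D" using x R by (simp add: D_def)
      show "\<exists>r>0. \<forall>y\<in>D. norm y < r \<longrightarrow> v y - z y \<le> \<delta>" if \<delta>: "\<delta> > 0" for \<delta>
      proof (intro exI[of _ "\<delta> / (m + 1)"] conjI ballI impI)
        fix y assume y: "y \<in> D" "norm y < \<delta> / (m + 1)"
        have yO: "y \<in> \<Omega>" "norm y \<le> R" using y by (auto simp: D_def)
        have "v y \<le> m * y $ k" using vm[OF yO] .
        also have "\<dots> \<le> m * norm y"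
          using m component_le_norm_cart[of y k] by (intro mult_left_mono) auto
        also have "\<dots> \<le> (m + 1) * norm y" by (simp add: algebra_simps)
        also have "\<dots> \<le> \<delta>" using y(2) m by (simp add: pos_less_divide_eq mult.commute)
        finally show "v y - z y \<le> \<delta>" using z0[of y] yO closure_subset[of \<Omega>] by auto
      qed (use \<delta> m in simp)
      show "\<exists>d l. has_lap z y d l \<and> l \<le> - C" if "y \<in> D" for y
      proof -
        have yc: "y \<in> closure \<Omega>" using that closure_subset[of \<Omega>] by (auto simp: D_def)
        obtain d where d: "has_lap (\<lambda>x. 2 * R * x $ k - (x $ k)\<^sup>2) y d (-2)"
          using has_lap_coord_quadratic by blast
        define c where "c = 2 * real N * (2 * real N + 2 - real CARD('n))"
        have c: "c \<ge> 0" by (simp add: c_def N_def)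
        have "y \<noteq> q" "y \<noteq> q'" using a0[OF yc] ab'[OF yc] by (auto simp: a_def b_def)
        then obtain d1 d2 where
          "has_lap (\<lambda>x. inverse (a x) ^ N) y d1 (c * inverse (a y) ^ (N + 1))"
          "has_lap (\<lambda>x. inverse (b x) ^ N) y d2 (c * inverse (b y) ^ (N + 1))"
          unfolding a_def b_def c_def using has_lap_inv_pow by blast
        note lapG = has_lap_diff[OF this, folded G_def]
        have "has_lap z y (((1 + \<epsilon> * \<kappa>) * m) *\<^sub>R axis k 1 - (\<epsilon> * m) *\<^sub>R (d1 - d2) + C *\<^sub>R d)
           ((1 + \<epsilon> * \<kappa>) * m * 0 - \<epsilon> * m * (c * inverse (a y) ^ (N + 1) - c * inverse (b y) ^ (N + 1)) + C * (-2))"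
          unfolding z_def by (intro has_lap_add has_lap_diff has_lap_cmult has_lap_coord d lapG)
        moreover have "c * inverse (b y) ^ (N + 1) \<le> c * inverse (a y) ^ (N + 1)"
          using c a0[OF yc] ab'[OF yc] by (intro mult_left_mono power_mono le_imp_inverse_le) auto
        then have "\<epsilon> * m * (c * inverse (a y) ^ (N + 1) - c * inverse (b y) ^ (N + 1)) \<ge> 0"
          using \<epsilon> m by (intro mult_nonneg_nonneg) auto
        ultimately show ?thesis using C by (intro exI conjI) (assumption, simp)
      qed
      show "v y \<le> z y" if "y \<in> frontier D" "y \<noteq> 0" for y
      proof -
        note fr = frontier_Int_ball_cases[OF op, of y 0 R, folded D_def, OF that(1)]
        have yR: "norm y \<le> R" using fr(2) by simp
        from fr(3) show ?thesis
        proof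
          assume "y \<in> frontier \<Omega>"
          then have "v y \<le> 0" using v that(2) by (auto simp: cone_sub_def)
          then show ?thesis using z0[OF fr(1) yR] by simp
        next
          assume y: "y \<in> \<Omega> \<and> dist 0 y = R"
          then have "norm (y - q) \<ge> 2 * s" using norm_triangle_ineq2[of y q] by (simp add: R_def)
          then have "a y \<ge> (2 * s)\<^sup>2" unfolding a_def using s by (intro power_mono) auto
          then have "G y \<le> \<kappa> * y $ k" unfolding \<kappa>_def using s by (intro G_upper fr) auto
          then have "\<epsilon> * m * G y \<le> \<epsilon> * m * (\<kappa> * y $ k)" using \<epsilon> m by (intro mult_left_mono) auto
          then have "m * y $ k \<le> z y"
            using quad[OF fr(1) yR] by (simp add: z_def algebra_simps)
          then show ?thesis using vm[of y] y by simp
        qed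
      qed
    qed
    also have "z x \<le> (\<theta> * m + 2 * R * C) * x $ k"
    proof -
      have xc: "x \<in> closure \<Omega>" using x closure_subset by blast
      have xk: "x $ k \<ge> 0" using clo[OF xc] by blast
      have "2 * \<kappa> * x $ k \<le> G x"
        using G_lower[OF xc x(2)] mult_right_mono[OF \<kappa>2 xk] by linarith
      then have "\<epsilon> * m * (2 * \<kappa> * x $ k) \<le> \<epsilon> * m * G x" using \<epsilon> m by (intro mult_left_mono) auto
      moreover have "C * (2 * R * x $ k - (x $ k)\<^sup>2) \<le> C * (2 * R * x $ k)"
        using C by (intro mult_left_mono) auto
      ultimately show ?thesis by (simp add: z_def \<theta>_def algebra_simps)
    qed
    finally show ?thesis .
  qed
  show thesis
  proof (rule that[of R \<theta>])
    show "R > 1" using s norm_ge_zero[of q] unfolding R_def by linarith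
    show "0 \<le> \<theta>" "\<theta> < 1" using \<epsilon> \<kappa> by (auto simp: \<theta>_def)
  qed (rule step)
qed

text \<open>\<open>S\<close> collects the slopes valid near the vertex. Applied to v(\<rho>
  x)/\<rho>, the flattening step turns a slope m into \<theta> m + \<epsilon>, the error being the
  \<open>C\<close> term at a small scale. Hence \<open>\<mu>\<close>, the infimum of
  \<open>S\<close>, satisfies \<mu> <= \<theta> m for every m in \<open>S\<close>, which forces it
  to be 0.\<close>

theorem cone_sub_sublinear:
  fixes v :: "real^'n \<Rightarrow> real" and C M :: real
  assumes n: "CARD('n) \<ge> 2"
    and cone: "open_cone \<Omega>" and half: "\<Omega> \<subseteq> {x. x $ k > 0}"
    and q: "q $ k > 0" "q \<notin> closure \<Omega>"
    and v: "cone_sub \<Omega> C v" and C: "C \<ge> 0" and M: "\<And>x. x \<in> \<Omega> \<Longrightarrow> v x \<le> M"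
    and \<eta>: "\<eta> > 0"
  obtains \<rho> where "\<rho> > 0" "\<And>x. x \<in> \<Omega> \<Longrightarrow> norm x \<le> \<rho> \<Longrightarrow> v x \<le> \<eta> * x $ k"
proof -
  have op: "open \<Omega>" using cone by (simp add: open_cone_def)
  obtain e where e: "e > 0" "ball q e \<inter> \<Omega> = {}"
  proof -
    obtain e where "e > 0" "ball q e \<subseteq> - closure \<Omega>"
      using q(2) openE[of "- closure \<Omega>" q] by auto
    then show thesis using that closure_subset[of \<Omega>] by blast
  qed
  obtain R \<theta> where R: "R > 1" and \<theta>: "0 \<le> \<theta>" "\<theta> < 1"
    and step: "\<And>C v m x. \<lbrakk>C \<ge> 0; m \<ge> 0; cone_sub \<Omega> C v;
           \<And>x. x \<in> \<Omega> \<Longrightarrow> norm x \<le> R \<Longrightarrow> v x \<le> m * x $ k;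
           x \<in> \<Omega>; norm x \<le> 1\<rbrakk> \<Longrightarrow> v x \<le> (\<theta> * m + 2 * R * C) * x $ k"
    using cone_sub_flatten_step[OF op half q(1) e] by metis
  define S where "S = {m. m \<ge> 0 \<and> (\<exists>\<rho>>0. \<forall>x\<in>\<Omega>. norm x \<le> \<rho> \<longrightarrow> v x \<le> m * x $ k)}"
  define M' where "M' = max M 0"
  define K where "K = 4 * M' + 8 * (CARD('n) * M' + C)"
  have M': "M' \<ge> 0" "\<And>x. x \<in> \<Omega> \<Longrightarrow> v x \<le> M'" using M by (auto simp: M'_def le_max_iff_disj)
  have K: "K \<ge> 0" using M' C by (simp add: K_def)
  have "v x \<le> (K + 2 * C) * x $ k" if "x \<in> \<Omega>" "norm x < 1" for x
    using cone_sub_bound_linear[OF n op half v C K _ that]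
      cone_sub_bound_div_norm[OF op half v C M'] unfolding K_def by blast
  then have "K + 2 * C \<in> S" unfolding S_def using K C by (auto intro!: exI[of _ "1/2"])
  then have ne: "S \<noteq> {}" by blast
  have bdd: "bdd_below S" by (rule bdd_belowI[of _ 0]) (simp add: S_def)
  have S_step: "\<theta> * m + \<epsilon> \<in> S" if m: "m \<in> S" and \<epsilon>: "\<epsilon> > 0" for m \<epsilon>
  proof -
    obtain \<rho>0 where \<rho>0: "\<rho>0 > 0" "\<And>x. x \<in> \<Omega> \<Longrightarrow> norm x \<le> \<rho>0 \<Longrightarrow> v x \<le> m * x $ k"
      using m by (auto simp: S_def)
    have m0: "m \<ge> 0" using m by (simp add: S_def)
    \<comment> \<open>The first entry keeps the dilated ball of radius \<open>R\<close> where the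
      slope \<open>m\<close> is known; the second makes the error 2 R \<rho> C at most
      \<open>\<epsilon>\<close>.\<close>
    define \<rho> where "\<rho> = min (\<rho>0 / R) (\<epsilon> / (2 * R * C + 1))"
    have RC: "2 * R * C + 1 > 0" using R C by (simp add: add_nonneg_pos)
    have \<rho>: "\<rho> > 0" using \<rho>0(1) \<epsilon> R RC by (simp add: \<rho>_def)
    have \<rho>R: "\<rho> * R \<le> \<rho>0" using R by (simp add: \<rho>_def min_le_iff_disj flip: pos_le_divide_eq)
    have "\<rho> * (2 * R * C + 1) \<le> \<epsilon>"
      using RC by (simp add: \<rho>_def min_le_iff_disj flip: pos_le_divide_eq)
    then have \<rho>C: "2 * R * (\<rho> * C) \<le> \<epsilon>" using \<rho> by (simp add: algebra_simps)
    have bound: "v (\<rho> *\<^sub>R x) / \<rho> \<le> (\<theta> * m + 2 * R * (\<rho> * C)) * x $ k" if "x \<in> \<Omega>" "norm x \<le> 1" for x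
    proof (rule step[OF _ m0 cone_sub_scale[OF cone \<rho> v] _ that])
      show "\<rho> * C \<ge> 0" using \<rho> C by simp
      fix y assume y: "y \<in> \<Omega>" "norm y \<le> R"
      have "norm (\<rho> *\<^sub>R y) \<le> \<rho>0"
      proof -
        have "\<rho> * norm y \<le> \<rho> * R" using y \<rho> by (intro mult_left_mono) auto
        moreover have "norm (\<rho> *\<^sub>R y) = \<rho> * norm y" using \<rho> by simp
        ultimately show ?thesis using \<rho>R by linarith
      qed
      then have "v (\<rho> *\<^sub>R y) \<le> m * (\<rho> * y $ k)"
        using \<rho>0(2)[of "\<rho> *\<^sub>R y"] open_cone_scale[OF cone \<rho>] y(1) by simp
      then show "v (\<rho> *\<^sub>R y) / \<rho> \<le> m * y $ k" using \<rho> by (simp add: field_simps)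
    qed
    have "v y \<le> (\<theta> * m + \<epsilon>) * y $ k" if y: "y \<in> \<Omega>" "norm y \<le> \<rho>" for y
    proof -
      have yk: "y $ k > 0" using half y by auto
      have "v (\<rho> *\<^sub>R inverse \<rho> *\<^sub>R y) / \<rho> \<le> (\<theta> * m + 2 * R * (\<rho> * C)) * (inverse \<rho> *\<^sub>R y) $ k"
      proof (rule bound)
        show "inverse \<rho> *\<^sub>R y \<in> \<Omega>" using open_cone_scale[OF cone, of "inverse \<rho>"] \<rho> y by simp
        show "norm (inverse \<rho> *\<^sub>R y) \<le> 1" using \<rho> y by (simp add: field_simps)
      qed
      then have "v y \<le> (\<theta> * m + 2 * R * (\<rho> * C)) * y $ k" using \<rho> by (simp add: field_simps)
      also have "\<dots> \<le> (\<theta> * m + \<epsilon>) * y $ k" using \<rho>C yk by (intro mult_right_mono) auto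
      finally show ?thesis .
    qed
    then show ?thesis unfolding S_def using \<rho> \<theta> m0 \<epsilon> by (auto intro!: exI[of _ \<rho>])
  qed
  define \<mu> where "\<mu> = Inf S"
  have le: "\<mu> \<le> \<theta> * m" if "m \<in> S" for m
    by (rule field_le_epsilon) (use S_step[OF that] bdd in \<open>auto simp: \<mu>_def intro: cInf_lower\<close>)
  have "\<mu> \<le> 0"
  proof (rule ccontr)
    assume "\<not> \<mu> \<le> 0" then have \<mu>: "\<mu> > 0" by simp
    \<comment> \<open>A factor above 1 whose product with \<open>\<theta>\<close> stays below 1:
      \<theta> (2 - \<theta>) = 1 - (1 - \<theta>)^2.\<close>
    have "(2 - \<theta>) * \<mu> > Inf S" using \<mu> \<theta> by (simp add: \<mu>_def[symmetric])
    then obtain m where m: "m \<in> S" "m < (2 - \<theta>) * \<mu>" using ne cInf_lessD by blast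
    have "\<mu> \<le> \<theta> * m" using le m by blast
    also have "\<dots> \<le> \<theta> * ((2 - \<theta>) * \<mu>)" using m \<theta> by (intro mult_left_mono) auto
    also have "\<dots> = \<mu> - (1 - \<theta>)\<^sup>2 * \<mu>" by (simp add: power2_eq_square algebra_simps)
    also have "\<dots> < \<mu>" using \<mu> \<theta> by simp
    finally show False by simp
  qed
  then obtain m where m: "m \<in> S" "m < \<eta>" using ne \<eta> cInf_lessD[of S \<eta>] unfolding \<mu>_def by auto
  then obtain \<rho> where \<rho>: "\<rho> > 0" "\<And>x. x \<in> \<Omega> \<Longrightarrow> norm x \<le> \<rho> \<Longrightarrow> v x \<le> m * x $ k"
    by (auto simp: S_def)
  show thesis
  proof (rule that[OF \<rho>(1)])
    fix x assume x: "x \<in> \<Omega>" "norm x \<le> \<rho>"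
    have "x $ k > 0" using half x by auto
    then show "v x \<le> \<eta> * x $ k" using \<rho>(2)[OF x] m(2) mult_right_mono[of m \<eta> "x $ k"] by linarith
  qed
qed

section \<open>Derivatives at the boundary and in the interior\<close>

text \<open>Along the ray the defining function starts at 0 with slope
  \<open>D\<phi> p \<bullet> d\<close>, so its sign for small times, and with it the side of the
  boundary, is known.\<close>

lemma local_defining_direction:
  assumes loc: "local_C1beta_defining \<Omega> \<beta> p r \<phi> D\<phi>" and p: "p \<in> frontier \<Omega>"
  shows "D\<phi> p \<bullet> d < 0 \<Longrightarrow> \<exists>t0>0. \<forall>t. 0 < t \<and> t < t0 \<longrightarrow> p + t *\<^sub>R d \<in> \<Omega>"
    and "D\<phi> p \<bullet> d > 0 \<Longrightarrow> \<exists>t0>0. \<forall>t. 0 < t \<and> t < t0 \<longrightarrow> p + t *\<^sub>R d \<notin> closure \<Omega>"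
proof -
  note l = loc[unfolded local_C1beta_defining_def]
  have r: "r > 0" and der: "(\<phi> has_derivative (\<lambda>h. D\<phi> p \<bullet> h)) (at p)"
    and inside: "\<Omega> \<inter> ball p r = {x \<in> ball p r. \<phi> x < 0}"
    and bd: "frontier \<Omega> \<inter> ball p r = {x \<in> ball p r. \<phi> x = 0}"
    using l by auto
  have "p \<in> {x \<in> ball p r. \<phi> x = 0}" unfolding bd[symmetric] using p r by simp
  then have p0: "\<phi> p = 0" by simp
  have "((\<lambda>t. p + t *\<^sub>R d) has_derivative (\<lambda>h. h *\<^sub>R d)) (at (0::real))"
    by (auto intro!: derivative_eq_intros)
  moreover have "(\<phi> has_derivative (\<lambda>h. D\<phi> p \<bullet> h)) (at (p + 0 *\<^sub>R d))" using der by simp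
  ultimately have "((\<lambda>t. \<phi> (p + t *\<^sub>R d)) has_derivative (\<lambda>h. D\<phi> p \<bullet> (h *\<^sub>R d))) (at 0)"
    by (rule has_derivative_compose)
  then have D: "((\<lambda>t. \<phi> (p + t *\<^sub>R d)) has_real_derivative D\<phi> p \<bullet> d) (at 0)"
    by (rule has_derivative_imp_has_field_derivative) simp
  define t1 where "t1 = r / (norm d + 1)"
  have "norm d + 1 > 0" by (simp add: add_nonneg_pos)
  then have t1: "t1 > 0" using r by (simp add: t1_def)
  have inb: "p + t *\<^sub>R d \<in> ball p r" if "0 < t" "t < t1" for t
  proof -
    have "t * norm d \<le> t * (norm d + 1)" using that by (intro mult_left_mono) auto
    also have "\<dots> < r" using that \<open>norm d + 1 > 0\<close> by (simp add: t1_def pos_less_divide_eq)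
    finally show ?thesis using that by (simp add: dist_norm)
  qed
  {
    assume "D\<phi> p \<bullet> d < 0"
    from DERIV_neg_dec_right[OF D this] obtain t0 where
      t0: "t0 > 0" "\<And>h. h > 0 \<Longrightarrow> h < t0 \<Longrightarrow> \<phi> (p + h *\<^sub>R d) < 0" by (auto simp: p0)
    have "p + t *\<^sub>R d \<in> \<Omega>" if t: "0 < t \<and> t < min t0 t1" for t
    proof -
      have "p + t *\<^sub>R d \<in> {x \<in> ball p r. \<phi> x < 0}" using inb[of t] t0(2)[of t] t by auto
      then show ?thesis unfolding inside[symmetric] by blast
    qed
    then show "\<exists>t0>0. \<forall>t. 0 < t \<and> t < t0 \<longrightarrow> p + t *\<^sub>R d \<in> \<Omega>"
      using t1 t0(1) by (intro exI[of _ "min t0 t1"]) auto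
  }
  {
    assume "D\<phi> p \<bullet> d > 0"
    from DERIV_pos_inc_right[OF D this] obtain t0 where
      t0: "t0 > 0" "\<And>h. h > 0 \<Longrightarrow> h < t0 \<Longrightarrow> \<phi> (p + h *\<^sub>R d) > 0" by (auto simp: p0)
    have "p + t *\<^sub>R d \<notin> closure \<Omega>" if t: "0 < t \<and> t < min t0 t1" for t
    proof -
      let ?x = "p + t *\<^sub>R d"
      have x: "?x \<in> ball p r" "\<phi> ?x > 0" using inb[of t] t0(2)[of t] t by auto
      have "?x \<notin> {x \<in> ball p r. \<phi> x = 0}" "?x \<notin> {x \<in> ball p r. \<phi> x < 0}" using x(2) by auto
      then have "?x \<notin> frontier \<Omega>" "?x \<notin> \<Omega>" using x(1) unfolding bd[symmetric] inside[symmetric] by blast+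
      then show ?thesis using frontier_def interior_subset by blast
    qed
    then show "\<exists>t0>0. \<forall>t. 0 < t \<and> t < t0 \<longrightarrow> p + t *\<^sub>R d \<notin> closure \<Omega>"
      using t1 t0(1) by (intro exI[of _ "min t0 t1"]) auto
  }
qed

text \<open>On the boundary \<open>G\<close> is only a continuous extension of the gradient. The
  mean value theorem on the open segment shows that its value at \<open>p\<close> still computes
  slopes along rays entering the domain.\<close>

lemma one_sided_derivative:
  fixes u :: "'a::euclidean_space \<Rightarrow> real" and G :: "'a \<Rightarrow> 'a"
  assumes t0: "t0 > 0" "\<And>t. 0 < t \<Longrightarrow> t < t0 \<Longrightarrow> p + t *\<^sub>R d \<in> \<Omega>"
    and S: "\<Omega> \<subseteq> S" "p \<in> S" and cu: "continuous_on S u" and cG: "continuous_on S G"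
    and der: "\<And>x. x \<in> \<Omega> \<Longrightarrow> (u has_derivative (\<lambda>h. G x \<bullet> h)) (at x)"
  shows "((\<lambda>t. (u (p + t *\<^sub>R d) - u p) / t) \<longlongrightarrow> G p \<bullet> d) (at_right 0)"
proof (rule tendstoI)
  fix e :: real assume e: "e > 0"
  let ?l = "\<lambda>t. p + t *\<^sub>R d"
  have lS: "?l t \<in> S" if "0 \<le> t" "t < t0" for t
    using that t0(2)[of t] S by (cases "t = 0") auto
  have cl: "continuous_on {0..<t0} ?l" by (intro continuous_intros)
  have cgl: "continuous_on {0..<t0} (\<lambda>t. G (?l t) \<bullet> d)"
    by (intro continuous_on_inner continuous_on_const continuous_on_compose2[OF cG cl]) (use lS in auto)
  have cul: "continuous_on {0..<t0} (\<lambda>t. u (?l t))"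
    by (intro continuous_on_compose2[OF cu cl]) (use lS in auto)
  have "\<exists>\<delta>>0. \<forall>x\<in>{0..<t0}. dist x 0 < \<delta> \<longrightarrow> dist (G (?l x) \<bullet> d) (G (?l 0) \<bullet> d) < e"
    using cgl[unfolded continuous_on_iff, rule_format, of 0 e] t0(1) e by auto
  then obtain \<delta> where \<delta>: "\<delta> > 0"
    "\<And>t. 0 \<le> t \<Longrightarrow> t < t0 \<Longrightarrow> t < \<delta> \<Longrightarrow> dist (G (?l t) \<bullet> d) (G p \<bullet> d) < e"
    by auto
  have dl: "((\<lambda>t. u (?l t)) has_real_derivative G (?l t) \<bullet> d) (at t)" if t: "0 < t" "t < t0" for t
  proof -
    have "(?l has_derivative (\<lambda>h. h *\<^sub>R d)) (at t)" by (auto intro!: derivative_eq_intros)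
    from has_derivative_compose[OF this der[OF t0(2)[OF t]]]
    show ?thesis by (rule has_derivative_imp_has_field_derivative) simp
  qed
  have "dist ((u (?l t) - u p) / t) (G p \<bullet> d) < e" if t: "0 < t" "t < min t0 \<delta>" for t
  proof -
    have "\<exists>l z. 0 < z \<and> z < t \<and> ((\<lambda>t. u (?l t)) has_real_derivative l) (at z) \<and> u (?l t) - u (?l 0) = (t - 0) * l"
    proof (rule MVT)
      show "continuous_on {0..t} (\<lambda>t. u (?l t))"
        by (rule continuous_on_subset[OF cul]) (use t in auto)
      show "\<And>x. 0 < x \<Longrightarrow> x < t \<Longrightarrow> (\<lambda>t. u (?l t)) differentiable at x"
        using dl t unfolding real_differentiable_def by (metis less_trans min_less_iff_conj)
    qed (use t in auto)
    then obtain l z where z: "0 < z" "z < t" "((\<lambda>t. u (?l t)) has_real_derivative l) (at z)"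
      "u (?l t) - u p = t * l" by auto
    have "l = G (?l z) \<bullet> d" using DERIV_unique[OF z(3) dl] z t by auto
    then show ?thesis using z t \<delta>(2)[of z] by auto
  qed
  then show "\<forall>\<^sub>F t in at_right 0. dist ((u (?l t) - u p) / t) (G p \<bullet> d) < e"
    unfolding eventually_at_right_field using t0(1) \<delta>(1)
    by (intro exI[of _ "min t0 \<delta>"]) auto
qed

lemma DERIV_right_quotient:
  fixes \<psi> :: "real \<Rightarrow> real"
  assumes "(\<psi> has_real_derivative l) (at 0)" "\<psi> 0 = 0"
  shows "((\<lambda>t. \<psi> t / t) \<longlongrightarrow> l) (at_right 0)"
  using assms unfolding DERIV_def by (simp add: filterlim_at_split)

lemma DERIV_inv_pow_line:
  fixes w d :: "'a::real_inner"
  assumes "w \<noteq> 0"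
  shows "((\<lambda>t. inverse ((norm (w + t *\<^sub>R d))\<^sup>2) ^ N) has_real_derivative
     - (N * inverse ((norm w)\<^sup>2) ^ (N + 1)) * (2 * (w \<bullet> d))) (at 0)"
proof -
  have e: "(norm (w + t *\<^sub>R d))\<^sup>2 = (norm w)\<^sup>2 + 2 * (w \<bullet> d) * t + (norm d)\<^sup>2 * t\<^sup>2" for t
    unfolding power2_norm_eq_inner
    by (simp add: inner_add_left inner_add_right inner_commute power2_eq_square algebra_simps)
  have "((\<lambda>t. (norm w)\<^sup>2 + 2 * (w \<bullet> d) * t + (norm d)\<^sup>2 * t\<^sup>2) has_real_derivative 2 * (w \<bullet> d)) (at 0)"
    by (auto intro!: derivative_eq_intros)
  moreover have "((\<lambda>y. inverse y ^ N) has_real_derivative - (N * inverse ((norm w)\<^sup>2) ^ (N + 1)))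
      (at ((norm w)\<^sup>2 + 2 * (w \<bullet> d) * 0 + (norm d)\<^sup>2 * 0\<^sup>2))"
    using DERIV_inverse_power[of "(norm w)\<^sup>2" N] assms by simp
  ultimately show ?thesis unfolding e by (rule DERIV_chain2[rotated])
qed

text \<open>A touching function for \<open>G \<bullet> e\<close>, made strict by a quadratic, is touched nearby by the
  difference quotients of \<open>u\<close>, which do have a Laplacian.\<close>

lemma visc_sub_directional_derivative:
  fixes u :: "real^'n \<Rightarrow> real" and G :: "real^'n \<Rightarrow> real^'n"
  assumes op: "open \<Omega>" and cG: "continuous_on \<Omega> G"
    and der: "\<And>x. x \<in> \<Omega> \<Longrightarrow> (u has_derivative (\<lambda>h. G x \<bullet> h)) (at x)"
    and lap: "\<And>x. x \<in> \<Omega> \<Longrightarrow> has_lap u x (G x) (g x)"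
    and M: "\<And>x. x \<in> \<Omega> \<Longrightarrow> norm (G x) \<le> M"
    and g: "\<And>x y. x \<in> \<Omega> \<Longrightarrow> y \<in> \<Omega> \<Longrightarrow> \<bar>g x - g y\<bar> \<le> L * \<bar>u x - u y\<bar>"
    and L: "L \<ge> 0" and e: "norm e = 1" and C: "C > L * M"
  shows "visc_sub \<Omega> C (\<lambda>x. G x \<bullet> e)"
  unfolding visc_sub_def
proof (intro ballI allI impI)
  fix x0 r z
  assume x0: "x0 \<in> \<Omega>" and r: "(r::real) > 0" and sub: "ball x0 r \<subseteq> \<Omega>"
    and cz: "continuous_on (ball x0 r) z"
    and lz: "\<forall>x\<in>ball x0 r. \<exists>d l. has_lap z x d l \<and> l \<le> - C"
  show "\<exists>x\<in>ball x0 r. G x \<bullet> e - z x > G x0 \<bullet> e - z x0"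
  proof (rule ccontr)
    assume "\<not> ?thesis"
    then have mx: "\<And>x. x \<in> ball x0 r \<Longrightarrow> G x \<bullet> e - z x \<le> G x0 \<bullet> e - z x0" by (auto simp: not_less)
    define s where "s = r / 2"
    have s: "s > 0" "s < r" "s + s \<le> r" using r by (auto simp: s_def)
    define n where "n = real CARD('n)"
    have n: "n > 0" by (simp add: n_def)
    \<comment> \<open>The added quadratic has Laplacian 2 n \<kappa> = (C - L M)/2, half of the
      available gap, so strictness survives.\<close>
    define \<kappa> where "\<kappa> = (C - L * M) / (4 * n)"
    have \<kappa>: "\<kappa> > 0" using C n by (simp add: \<kappa>_def)
    \<comment> \<open>An intermediate ball: points within \<open>s\<close> of \<open>x0\<close> can
      be translated by \<open>t *\<^sub>R e\<close> inside it, and its compactness gives uniform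
      continuity of the derivative.\<close>
    define s' where "s' = 3 * r / 4"
    have cs: "cball x0 s' \<subseteq> \<Omega>" "s' > s" "s' < r" using sub r by (auto simp: s'_def s_def)
    have "uniformly_continuous_on (cball x0 s') (\<lambda>x. G x \<bullet> e)"
      by (intro compact_uniformly_continuous continuous_intros continuous_on_subset[OF cG cs(1)]) auto
    then obtain \<delta> where \<delta>: "\<delta> > 0"
      "\<And>x y. x \<in> cball x0 s' \<Longrightarrow> y \<in> cball x0 s' \<Longrightarrow> dist y x < \<delta> \<Longrightarrow> dist (G y \<bullet> e) (G x \<bullet> e) < \<kappa> * s\<^sup>2 / 4"
      unfolding uniformly_continuous_on_def using \<kappa> s by (metis (no_types, lifting) divide_pos_pos mult_pos_pos zero_less_numeral zero_less_power)
    define t where "t = min (\<delta> / 2) (s' - s)"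
    have t: "t > 0" "t < \<delta>" "t \<le> s' - s" using \<delta>(1) cs by (auto simp: t_def)
    define w where "w = (\<lambda>x. (u (x + t *\<^sub>R e) - u x) / t)"
    have line: "x + \<tau> *\<^sub>R e \<in> cball x0 s'" if "x \<in> cball x0 s" "0 \<le> \<tau>" "\<tau> \<le> t" for x \<tau>
    proof -
      have "dist x0 (x + \<tau> *\<^sub>R e) \<le> dist x0 x + norm (\<tau> *\<^sub>R e)"
        using dist_triangle[of x0 "x + \<tau> *\<^sub>R e" x] by (simp add: dist_norm)
      then show ?thesis using that t e by auto
    qed
    have wG: "\<exists>\<xi>. 0 \<le> \<xi> \<and> \<xi> \<le> t \<and> w x = G (x + \<xi> *\<^sub>R e) \<bullet> e" if x: "x \<in> cball x0 s" for x
    proof -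
      have "((\<lambda>\<tau>. u (x + \<tau> *\<^sub>R e)) has_real_derivative G (x + \<tau> *\<^sub>R e) \<bullet> e) (at \<tau>)" if "0 \<le> \<tau>" "\<tau> \<le> t" for \<tau>
      proof -
        have "((\<lambda>\<tau>. x + \<tau> *\<^sub>R e) has_derivative (\<lambda>h. h *\<^sub>R e)) (at \<tau>)" by (auto intro!: derivative_eq_intros)
        moreover have "x + \<tau> *\<^sub>R e \<in> \<Omega>" using line[OF x that] cs by blast
        ultimately show ?thesis
          by (intro has_derivative_imp_has_field_derivative[OF has_derivative_compose[OF _ der]]) auto
      qed
      then have "\<exists>\<xi>>0. \<xi> < t \<and> u (x + t *\<^sub>R e) - u (x + 0 *\<^sub>R e) = (t - 0) * (G (x + \<xi> *\<^sub>R e) \<bullet> e)"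
        using t(1) by (intro MVT2) auto
      then obtain \<xi> where "0 < \<xi>" "\<xi> < t" "u (x + t *\<^sub>R e) - u x = t * (G (x + \<xi> *\<^sub>R e) \<bullet> e)"
        by auto
      then show ?thesis using t(1) by (intro exI[of _ \<xi>]) (simp add: w_def)
    qed
    have wclose: "\<bar>w x - G x \<bullet> e\<bar> < \<kappa> * s\<^sup>2 / 4" if x: "x \<in> cball x0 s" for x
    proof -
      obtain \<xi> where \<xi>: "0 \<le> \<xi>" "\<xi> \<le> t" "w x = G (x + \<xi> *\<^sub>R e) \<bullet> e" using wG[OF x] by blast
      have "dist (x + \<xi> *\<^sub>R e) x < \<delta>" using \<xi> t e by (simp add: dist_norm)
      then show ?thesis
        using \<delta>(2)[of x "x + \<xi> *\<^sub>R e"] line[OF x \<xi>(1,2)] x cs(2) \<xi>(3) by (auto simp: dist_real_def)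
    qed
    have cu: "continuous_on \<Omega> u"
      using der by (intro differentiable_imp_continuous_on)
        (auto simp: differentiable_on_def differentiable_def intro: has_derivative_at_withinI)
    define h where "h = (\<lambda>x. w x - (z x + \<kappa> * (norm (x - x0))\<^sup>2))"
    have "continuous_on (cball x0 s) h"
    proof -
      have A: "continuous_on (cball x0 s) (\<lambda>x. u (x + t *\<^sub>R e))"
        by (rule continuous_on_compose2[OF cu]) (use line t cs in \<open>auto intro!: continuous_intros subsetD[OF cs(1)]\<close>)
      have B: "continuous_on (cball x0 s) u" "continuous_on (cball x0 s) z"
        using cu cz cs(1,2) s by (auto elim!: continuous_on_subset)
      show ?thesis unfolding h_def w_def by (intro continuous_intros A B) (use t in auto)
    qed
    then obtain x1 where x1: "x1 \<in> cball x0 s" "\<And>y. y \<in> cball x0 s \<Longrightarrow> h y \<le> h x1"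
      using continuous_attains_sup[of "cball x0 s" h] s by auto
    have X0: "x0 \<in> cball x0 s" using s by simp
    \<comment> \<open>On the sphere the quadratic costs \<kappa> s^2, while passing from the
      derivative to the difference quotient costs less than \<kappa> s^2 / 4 at each of
      \<open>x0\<close> and \<open>x1\<close>; so the maximum of \<open>h\<close> is
      interior.\<close>
    have "norm (x1 - x0) \<noteq> s"
    proof
      assume b: "norm (x1 - x0) = s"
      have "h x0 \<le> h x1" using x1(2)[of x0] s by auto
      moreover have "G x1 \<bullet> e - z x1 \<le> G x0 \<bullet> e - z x0" using mx[of x1] x1(1) s by auto
      moreover have "\<kappa> * s\<^sup>2 > 0" using \<kappa> s by simp
      moreover have "w x1 - G x1 \<bullet> e < \<kappa> * s\<^sup>2 / 4" "G x0 \<bullet> e - w x0 < \<kappa> * s\<^sup>2 / 4"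
        using wclose[OF x1(1)] wclose[OF X0] by linarith+
      moreover have "h x1 = w x1 - (z x1 + \<kappa> * s\<^sup>2)" "h x0 = w x0 - z x0"
        by (simp_all add: h_def b)
      ultimately show False by linarith
    qed
    then have in1: "x1 \<in> ball x0 s" using x1(1) by (auto simp: dist_norm norm_minus_commute)
    then obtain \<rho> where \<rho>: "\<rho> > 0" "ball x1 \<rho> \<subseteq> ball x0 s" using openE[OF open_ball] by blast
    have O1: "x1 \<in> \<Omega>" "x1 + t *\<^sub>R e \<in> \<Omega>"
      using line[OF x1(1), of 0] line[OF x1(1), of t] t(1) cs(1) by auto
    obtain dz l where l: "has_lap z x1 dz l" "l \<le> - C" using lz in1 s by fastforce
    have wlap: "\<exists>d. has_lap w x1 d ((1/t) * (g (x1 + t *\<^sub>R e) - g x1))"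
      using has_lap_cmult[OF has_lap_diff[OF has_lap_translate[OF lap[OF O1(2)]] lap[OF O1(1)]], of "1/t"]
      unfolding w_def by auto
    then obtain d where "has_lap h x1 d
        ((1/t) * (g (x1 + t *\<^sub>R e) - g x1) - (l + \<kappa> * (2 * CARD('n))))"
      unfolding h_def using has_lap_diff[OF _ has_lap_add[OF l(1) has_lap_cmult[OF has_lap_sqdist]]] by meson
    then have "(1/t) * (g (x1 + t *\<^sub>R e) - g x1) - (l + \<kappa> * (2 * CARD('n))) \<le> 0"
      by (rule has_lap_local_max[OF _ \<rho>(1)]) (use \<rho>(2) x1(2) in auto)
    moreover have "\<kappa> * (2 * CARD('n)) = (C - L * M) / 2"
      using n by (simp add: \<kappa>_def n_def[symmetric])
    \<comment> \<open>The quotient \<open>w x1\<close> is a value of the derivative at a nearby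
      point, so u changes by at most M t over the step; the Lipschitz bound on \<open>g\<close> then
      controls the Laplacian of \<open>w\<close> by L M.\<close>
    moreover have "(1/t) * (g (x1 + t *\<^sub>R e) - g x1) \<ge> - (L * M)"
    proof -
      obtain \<xi> where \<xi>: "0 \<le> \<xi>" "\<xi> \<le> t" "w x1 = G (x1 + \<xi> *\<^sub>R e) \<bullet> e" using wG[OF x1(1)] by blast
      have "\<bar>w x1\<bar> \<le> norm (G (x1 + \<xi> *\<^sub>R e)) * norm e" unfolding \<xi>(3) by (rule Cauchy_Schwarz_ineq2)
      also have "\<dots> \<le> M" using M line[OF x1(1) \<xi>(1,2)] cs(1) e by auto
      finally have "\<bar>u (x1 + t *\<^sub>R e) - u x1\<bar> \<le> M * t" using t(1) by (simp add: w_def abs_divide pos_divide_le_eq)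
      then have "\<bar>g (x1 + t *\<^sub>R e) - g x1\<bar> \<le> L * (M * t)"
        using g[OF O1(2,1)] mult_left_mono[OF _ L] by (meson order_trans)
      then show ?thesis using t(1) by (simp add: field_simps)
    qed
    ultimately show False using l(2) C by simp
  qed
qed

text \<open>The open ball reaching to a nearest frontier point misses the frontier and is connected,
  so it lies on one side. Touching balls thus arise without any curvature bound on the
  boundary.\<close>

lemma nearest_frontier_point:
  fixes q p :: "'a::euclidean_space"
  assumes "p \<in> frontier \<Omega>"
  obtains y where "y \<in> frontier \<Omega>" "dist q y \<le> dist q p"
    "ball q (dist q y) \<subseteq> \<Omega> \<or> ball q (dist q y) \<inter> \<Omega> = {}"
proof -
  obtain y where y: "y \<in> frontier \<Omega>" "\<And>z. z \<in> frontier \<Omega> \<Longrightarrow> dist q y \<le> dist q z"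
    using distance_attains_inf[of "frontier \<Omega>" q] assms frontier_closed by (metis empty_iff)
  have "ball q (dist q y) \<inter> frontier \<Omega> = {}" using y(2) by (meson disjoint_iff leD mem_ball)
  then have "ball q (dist q y) \<subseteq> \<Omega> \<or> ball q (dist q y) \<inter> \<Omega> = {}"
    using connected_Int_frontier[OF connected_ball, of q "dist q y" \<Omega>] by blast
  then show thesis using that y assms by blast
qed

section \<open>The overdetermined problem\<close>

text \<open>\<open>G\<close> is a single function on the closure off the vertex: inside it is the
  gradient, and its boundary values carry the Neumann condition.\<close>

locale overdetermined_cone =
  fixes \<Omega> :: "(real^'n) set" and k :: 'n and \<beta> c :: real
    and f f' :: "real \<Rightarrow> real" and u :: "real^'n \<Rightarrow> real"
    and G :: "real^'n \<Rightarrow> real^'n" and H :: "real^'n \<Rightarrow> real^'n^'n"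
  assumes dim: "CARD('n) \<ge> 2"
    and cone: "open_cone \<Omega>"
    and half: "\<Omega> \<subseteq> {x. x $ k > 0}"
    and beta: "\<beta> > 0"
    and bdry: "C1beta_boundary_off0 \<Omega> \<beta>"
    and cf': "continuous_on UNIV f'"
    and df: "\<And>t. (f has_real_derivative f' t) (at t)"
    and cu: "continuous_on (closure \<Omega> - {0}) u"
    and cG: "continuous_on (closure \<Omega> - {0}) G"
    and du: "\<And>x. x \<in> \<Omega> \<Longrightarrow> (u has_derivative (\<lambda>h. G x \<bullet> h)) (at x)"
    and dG: "\<And>x. x \<in> \<Omega> \<Longrightarrow> (G has_derivative (\<lambda>h. H x *v h)) (at x)"
    and bu: "bounded (u ` \<Omega>)"
    and bG: "bounded (G ` \<Omega>)"
    and eq: "\<And>x. x \<in> \<Omega> \<Longrightarrow> (\<Sum>i\<in>UNIV. H x $ i $ i) + f (u x) = 0"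
    and pos: "\<And>x. x \<in> \<Omega> \<Longrightarrow> u x > 0"
    and dirichlet: "\<And>p. p \<in> frontier \<Omega> \<Longrightarrow> p \<noteq> 0 \<Longrightarrow> u p = 0"
    and neumann: "\<And>p \<nu>. p \<in> frontier \<Omega> \<Longrightarrow> p \<noteq> 0 \<Longrightarrow> exterior_normal \<Omega> p \<nu> \<Longrightarrow> G p \<bullet> \<nu> = c"
begin

lemma op: "open \<Omega>" using cone by (simp add: open_cone_def)

lemma zero_notin: "0 \<notin> \<Omega>" using half by auto

lemma frontier_iff: "p \<in> frontier \<Omega> \<longleftrightarrow> p \<in> closure \<Omega> \<and> p \<notin> \<Omega>"
  using op by (simp add: frontier_def interior_open)

lemma subset_closure: "\<Omega> \<subseteq> closure \<Omega> - {0}"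
  using zero_notin closure_subset by blast

lemma lap_u:
  assumes x: "x \<in> \<Omega>" shows "has_lap u x (G x) (- f (u x))"
proof -
  have "(\<Sum>i\<in>UNIV. H x $ i $ i) = - f (u x)" using eq[OF x] by linarith
  then show ?thesis using has_lap_of_hessian[OF op x du dG] by (simp only:)
qed

lemma u_bound: obtains M where "\<And>x. x \<in> \<Omega> \<Longrightarrow> u x \<le> M" "M \<ge> 0"
proof -
  obtain B where "\<And>x. x \<in> \<Omega> \<Longrightarrow> norm (u x) \<le> B" using bu unfolding bounded_iff by auto
  then have "u x \<le> \<bar>B\<bar>" if "x \<in> \<Omega>" for x using that by (metis abs_ge_self order_trans real_norm_def)
  then show thesis using that[of "\<bar>B\<bar>"] by simp
qed

lemma G_bound: obtains M where "\<And>x. x \<in> \<Omega> \<Longrightarrow> norm (G x) \<le> M"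
  using bG unfolding bounded_iff by auto

lemma f_lipschitz:
  obtains L where "L \<ge> 0" "\<And>a b. 0 \<le> a \<Longrightarrow> a \<le> M \<Longrightarrow> 0 \<le> b \<Longrightarrow> b \<le> M \<Longrightarrow> \<bar>f a - f b\<bar> \<le> L * \<bar>a - b\<bar>"
proof -
  have "continuous_on {0..M} f'" by (rule continuous_on_subset[OF cf']) simp
  then have "bounded (f' ` {0..M})" by (intro compact_imp_bounded compact_continuous_image compact_Icc)
  then obtain L where L: "\<And>t. t \<in> {0..M} \<Longrightarrow> norm (f' t) \<le> L"
    unfolding bounded_iff by blast
  have "norm (f a - f b) \<le> \<bar>L\<bar> * norm (a - b)" if "a \<in> {0..M}" "b \<in> {0..M}" for a b
  proof (rule field_differentiable_bound[of "{0..M}" f f'])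
    fix z assume "z \<in> {0..M}"
    then show "norm (f' z) \<le> \<bar>L\<bar>" using L[of z] by linarith
    show "(f has_field_derivative f' z) (at z within {0..M})" using df by (rule has_field_derivative_at_within)
  qed (use that in auto)
  then show thesis by (intro that[of "\<bar>L\<bar>"]) auto
qed

lemma f_bound: obtains C where "C \<ge> 0" "\<And>x. x \<in> \<Omega> \<Longrightarrow> \<bar>f (u x)\<bar> \<le> C"
proof -
  obtain M where M: "\<And>x. x \<in> \<Omega> \<Longrightarrow> u x \<le> M" "M \<ge> 0" using u_bound by blast
  have "continuous_on {0..M} f"
    by (rule continuous_at_imp_continuous_on) (use df DERIV_isCont in blast)
  then have "bounded (f ` {0..M})" by (intro compact_imp_bounded compact_continuous_image compact_Icc)
  then obtain C where C: "\<And>t. t \<in> {0..M} \<Longrightarrow> norm (f t) \<le> C"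
    unfolding bounded_iff by blast
  have "\<bar>f (u x)\<bar> \<le> \<bar>C\<bar>" if "x \<in> \<Omega>" for x
  proof -
    have "u x \<in> {0..M}" using M(1)[OF that] pos[OF that] by simp
    then show ?thesis using C[of "u x"] by simp
  qed
  then show thesis using that[of "\<bar>C\<bar>"] by auto
qed

text \<open>Boundary regularity enters the argument only here: everything later uses just the value
  of \<open>G p \<bullet> \<nu>\<close> and the side to which a ray from \<open>p\<close>
  points.\<close>

lemma normal_exists:
  assumes p: "p \<in> frontier \<Omega>" "p \<noteq> 0"
  obtains \<nu> where "norm \<nu> = 1" "G p \<bullet> \<nu> = c"
    "\<And>d. \<nu> \<bullet> d < 0 \<Longrightarrow> \<exists>t0>0. \<forall>t. 0 < t \<and> t < t0 \<longrightarrow> p + t *\<^sub>R d \<in> \<Omega>"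
    "\<And>d. \<nu> \<bullet> d > 0 \<Longrightarrow> \<exists>t0>0. \<forall>t. 0 < t \<and> t < t0 \<longrightarrow> p + t *\<^sub>R d \<notin> closure \<Omega>"
proof -
  obtain r \<phi> D\<phi> where loc: "local_C1beta_defining \<Omega> \<beta> p r \<phi> D\<phi>"
    using bdry p unfolding C1beta_boundary_off0_def by blast
  have nz: "D\<phi> p \<noteq> 0" using loc unfolding local_C1beta_defining_def by blast
  define \<nu> where "\<nu> = D\<phi> p /\<^sub>R norm (D\<phi> p)"
  have "exterior_normal \<Omega> p \<nu>" unfolding exterior_normal_def \<nu>_def using loc beta by blast
  moreover have "\<nu> \<bullet> d < 0 \<longleftrightarrow> D\<phi> p \<bullet> d < 0" "\<nu> \<bullet> d > 0 \<longleftrightarrow> D\<phi> p \<bullet> d > 0" for d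
    using nz by (auto simp: \<nu>_def divide_less_0_iff zero_less_divide_iff simp flip: divide_inverse_commute)
  moreover have "norm \<nu> = 1" using nz by (simp add: \<nu>_def)
  ultimately show thesis
    using that[of \<nu>] neumann[OF p] local_defining_direction[OF loc p(1)] by blast
qed

section \<open>Boundary slopes of u and the upper bound for c\<close>

lemma quotient_tendsto:
  assumes p: "p \<in> frontier \<Omega>" "p \<noteq> 0"
    and t0: "t0 > 0" "\<And>t. 0 < t \<Longrightarrow> t < t0 \<Longrightarrow> p + t *\<^sub>R d \<in> \<Omega>"
  shows "((\<lambda>t. u (p + t *\<^sub>R d) / t) \<longlongrightarrow> G p \<bullet> d) (at_right 0)"
  using one_sided_derivative[OF t0 subset_closure _ cu cG du] p dirichlet[OF p]
  by (simp add: frontier_iff)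

lemma inward_derivative_nonneg:
  assumes p: "p \<in> frontier \<Omega>" "p \<noteq> 0"
    and t0: "t0 > 0" "\<And>t. 0 < t \<Longrightarrow> t < t0 \<Longrightarrow> p + t *\<^sub>R d \<in> \<Omega>"
  shows "G p \<bullet> d \<ge> 0"
proof (rule tendsto_lowerbound)
  show "((\<lambda>t. u (p + t *\<^sub>R d) / t) \<longlongrightarrow> G p \<bullet> d) (at_right 0)"
    by (rule quotient_tendsto[OF p t0])
  show "\<forall>\<^sub>F t in at_right 0. 0 \<le> u (p + t *\<^sub>R d) / t"
    unfolding eventually_at_right_field
    using t0 pos by (intro exI[of _ t0]) (auto intro!: divide_nonneg_pos less_imp_le)
qed (rule trivial_limit_at_right_real)

lemma neumann_nonpos:
  assumes "p \<in> frontier \<Omega>" "p \<noteq> 0"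
  shows "c \<le> 0"
proof -
  obtain \<nu> where \<nu>: "norm \<nu> = 1" "G p \<bullet> \<nu> = c"
    "\<And>d. \<nu> \<bullet> d < 0 \<Longrightarrow> \<exists>t0>0. \<forall>t. 0 < t \<and> t < t0 \<longrightarrow> p + t *\<^sub>R d \<in> \<Omega>"
    using normal_exists[OF assms] by metis
  have "\<nu> \<bullet> - \<nu> < 0" using \<nu>(1) by (simp add: dot_square_norm)
  then obtain t0 where "t0 > 0" "\<forall>t. 0 < t \<and> t < t0 \<longrightarrow> p + t *\<^sub>R - \<nu> \<in> \<Omega>" using \<nu>(3) by blast
  then have "G p \<bullet> - \<nu> \<ge> 0" using inward_derivative_nonneg[OF assms] by blast
  then show ?thesis using \<nu>(2) by simp
qed

lemma gradient_zero:
  assumes c: "c = 0" and p: "p \<in> frontier \<Omega>" "p \<noteq> 0"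
  shows "G p = 0"
proof -
  obtain \<nu> where \<nu>: "norm \<nu> = 1" "G p \<bullet> \<nu> = c"
    "\<And>d. \<nu> \<bullet> d < 0 \<Longrightarrow> \<exists>t0>0. \<forall>t. 0 < t \<and> t < t0 \<longrightarrow> p + t *\<^sub>R d \<in> \<Omega>"
    using normal_exists[OF p] by metis
  \<comment> \<open>As \<open>G p \<bullet> \<nu>\<close> vanishes, adding \<open>- G p\<close> to
    the inner normal keeps the direction strictly inward, and the nonnegative slope along it equals
    -|G p|^2.\<close>
  let ?d = "- G p - \<nu>"
  have "\<nu> \<bullet> ?d < 0" using \<nu>(1,2) c by (simp add: inner_diff_right dot_square_norm inner_commute)
  then obtain t0 where "t0 > 0" "\<forall>t. 0 < t \<and> t < t0 \<longrightarrow> p + t *\<^sub>R ?d \<in> \<Omega>" using \<nu>(3) by blast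
  then have "G p \<bullet> ?d \<ge> 0" using inward_derivative_nonneg[OF p] by blast
  then have "G p \<bullet> G p \<le> 0" using \<nu>(2) c by (simp add: inner_diff_right)
  then have "G p \<bullet> G p = 0" using inner_ge_zero[of "G p"] by linarith
  then show ?thesis by simp
qed

section \<open>Touching balls on the lateral boundary\<close>

lemma exterior_point:
  assumes p: "p \<in> frontier \<Omega>" "p $ k > 0"
  obtains q where "q $ k > 0" "q \<notin> closure \<Omega>" "dist q p < norm p / 4"
proof -
  have p0: "p \<noteq> 0" using p(2) by auto
  obtain \<nu> where \<nu>: "norm \<nu> = 1"
    "\<And>d. \<nu> \<bullet> d > 0 \<Longrightarrow> \<exists>t0>0. \<forall>t. 0 < t \<and> t < t0 \<longrightarrow> p + t *\<^sub>R d \<notin> closure \<Omega>"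
    using normal_exists[OF p(1) p0] by metis
  have "\<nu> \<bullet> \<nu> > 0" using \<nu>(1) by (simp add: dot_square_norm)
  then obtain t0 where t0: "t0 > 0" "\<forall>t. 0 < t \<and> t < t0 \<longrightarrow> p + t *\<^sub>R \<nu> \<notin> closure \<Omega>" using \<nu>(2) by blast
  \<comment> \<open>A shift shorter than \<open>p $ k\<close> cannot reach the hyperplane; one
    shorter than a quarter of \<open>norm p\<close> meets the requirement of
    \<open>touching_ball\<close>.\<close>
  define t where "t = min t0 (min (p $ k) (norm p / 4)) / 2"
  have t: "0 < t" "t < t0" "t < p $ k" "t < norm p / 4" 
    using t0(1) p(2) zero_less_norm_iff[of p] p0 unfolding t_def min_def by (auto simp del: zero_less_norm_iff)
  show thesis
  proof (rule that[of "p + t *\<^sub>R \<nu>"])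
    have "\<bar>\<nu> $ k\<bar> \<le> 1" using component_le_norm_cart[of \<nu> k] \<nu>(1) by simp
    then have "t * - (\<nu> $ k) \<le> t * 1" using t(1) by (intro mult_left_mono) auto
    then show "(p + t *\<^sub>R \<nu>) $ k > 0" using t(3) by simp
    show "p + t *\<^sub>R \<nu> \<notin> closure \<Omega>" using t0(2) t by blast
    show "dist (p + t *\<^sub>R \<nu>) p < norm p / 4" using t \<nu>(1) by (simp add: dist_norm)
  qed
qed

text \<open>The touching radius is below a quarter of \<open>norm p\<close> while
  \<open>norm q\<close> exceeds three quarters of it. So even the ball of twice the touching radius
  avoids the vertex, which the exterior barrier needs.\<close>

lemma touching_ball:
  assumes p: "p \<in> frontier \<Omega>" "p \<noteq> 0" and q: "dist q p < norm p / 4" "q \<notin> frontier \<Omega>"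
  obtains y where "y \<in> frontier \<Omega>" "y \<noteq> 0" "dist q y > 0" "norm q > 2 * dist q y"
    "ball q (dist q y) \<subseteq> \<Omega> \<or> ball q (dist q y) \<inter> \<Omega> = {}"
proof -
  obtain y where y: "y \<in> frontier \<Omega>" "dist q y \<le> dist q p"
    "ball q (dist q y) \<subseteq> \<Omega> \<or> ball q (dist q y) \<inter> \<Omega> = {}"
    using nearest_frontier_point[OF p(1)] by blast
  have "dist q y > 0" using y(1) q(2) by auto
  moreover have "norm q > 2 * dist q y"
    using y(2) q(1) norm_triangle_ineq2[of p q] norm_ge_zero[of "p - q"] norm_minus_commute[of q p]
    unfolding dist_norm by linarith
  moreover have "y \<noteq> 0" using calculation by auto
  ultimately show thesis using that y by blast
qed

lemma cone_sub_u: obtains C where "C > 0" "cone_sub \<Omega> C u"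
proof -
  obtain C where C: "C \<ge> 0" "\<And>x. x \<in> \<Omega> \<Longrightarrow> \<bar>f (u x)\<bar> \<le> C" using f_bound by blast
  have "visc_sub \<Omega> (C + 1) u"
  proof (rule visc_sub_of_has_lap)
    fix x assume x: "x \<in> \<Omega>"
    have "- f (u x) > - (C + 1)" using C(2)[OF x] by linarith
    then show "\<exists>d l. has_lap u x d l \<and> l > - (C + 1)" using lap_u[OF x] by blast
  qed
  then show thesis using that[of "C + 1"] C(1) cu dirichlet by (auto simp: cone_sub_def)
qed

text \<open>By \<open>cone_sub_sublinear\<close>, the dilation u(\<rho> x)/\<rho> is at most
  \<open>\<eta> * Q\<close> near the touching ball, with \<open>\<eta>\<close> arbitrarily small. A
  barrier proportional to \<open>\<eta>\<close> and vanishing at \<open>y\<close> bounds its inward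
  normal slope there, which is - c at every scale because \<open>c\<close> is constant.\<close>

lemma neumann_nonneg:
  assumes p: "p \<in> frontier \<Omega>" "p $ k > 0"
  shows "c \<ge> 0"
proof -
  have p0: "p \<noteq> 0" using p(2) by auto
  obtain q where q: "q $ k > 0" "q \<notin> closure \<Omega>" "dist q p < norm p / 4"
    using exterior_point[OF p] by metis
  have "q \<notin> frontier \<Omega>" using q(2) by (simp add: frontier_iff)
  from touching_ball[OF p(1) p0 q(3) this] obtain y where y: "y \<in> frontier \<Omega>" "y \<noteq> 0"
    "dist q y > 0" "norm q > 2 * dist q y" "ball q (dist q y) \<subseteq> \<Omega> \<or> ball q (dist q y) \<inter> \<Omega> = {}"
    by metis
  define s where "s = dist q y"
  have s: "s > 0" "norm q > 2 * s" using y by (auto simp: s_def)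
  have yq: "norm (y - q) = s" by (simp add: s_def dist_norm norm_minus_commute)
  have "q \<in> ball q s" using s by simp
  moreover have "q \<notin> \<Omega>" using q(2) closure_subset by blast
  ultimately have "ball q s \<inter> \<Omega> = {}" using y(5) unfolding s_def by blast
  then have "ball q s \<inter> closure \<Omega> = {}"
    using open_Int_closure_eq_empty[OF open_ball] by blast
  then have away: "norm (x - q) \<ge> s" if "x \<in> closure \<Omega>" for x
  proof -
    have "x \<notin> ball q s" using that \<open>ball q s \<inter> closure \<Omega> = {}\<close> by blast
    then show ?thesis by (simp add: dist_norm norm_minus_commute)
  qed
  obtain C where C: "C > 0" "cone_sub \<Omega> C u" using cone_sub_u by blast
  obtain M where M: "\<And>x. x \<in> \<Omega> \<Longrightarrow> u x \<le> M" using u_bound by blast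
  define N where "N = CARD('n)"
  have N: "N > 0" by (simp add: N_def)
  \<comment> \<open>\<open>F\<close> vanishes on the touching sphere, is nonnegative on the closed
    cone and has negative Laplacian there; \<open>F2\<close> is its value at distance
    \<open>2 * s\<close>.\<close>
  define F where "F = (\<lambda>x. inverse (s\<^sup>2) ^ N - inverse ((norm (x - q))\<^sup>2) ^ N)"
  define F2 where "F2 = inverse (s\<^sup>2) ^ N - inverse ((2 * s)\<^sup>2) ^ N"
  have "inverse ((2 * s)\<^sup>2) < inverse (s\<^sup>2)" using s by (simp add: power_mult_distrib)
  then have F2: "F2 > 0" unfolding F2_def
    using N power_strict_mono[of "inverse ((2 * s)\<^sup>2)" "inverse (s\<^sup>2)" N] by simp
  have F0: "F x \<ge> 0" if "x \<in> closure \<Omega>" for x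
  proof -
    have "inverse ((norm (x - q))\<^sup>2) ^ N \<le> inverse (s\<^sup>2) ^ N"
      using away[OF that] s by (intro power_mono le_imp_inverse_le) auto
    then show ?thesis by (simp add: F_def)
  qed
  \<comment> \<open>\<open>Q\<close> bounds the norm on the ball of radius \<open>2 * s\<close>, and
    P F2 = Q makes the barrier \<eta> P F equal to \<eta> Q on the outer sphere.\<close>
  define Q where "Q = norm q + 2 * s"
  have Q: "Q > 0" unfolding Q_def using s norm_ge_zero[of q] by linarith
  define P where "P = Q / F2"
  have P: "P > 0" using Q F2 by (simp add: P_def)
  define cN where "cN = 2 * real N * (2 * real N + 2 - real CARD('n))"
  have cN: "cN > 0" using N by (simp add: cN_def N_def)
  \<comment> \<open>Lower bound for minus the Laplacian of P F within distance \<open>2 * s\<close>;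
    with \<rho> C <= \<eta> c1 it absorbs the rescaled right-hand side.\<close>
  define c1 where "c1 = P * (cN * inverse ((2 * s)\<^sup>2) ^ (N + 1))"
  have c1: "c1 > 0" using P cN s by (simp add: c1_def)
  \<comment> \<open>Bounds the slope of \<open>F\<close> at \<open>y\<close> in any unit direction.
    Like \<open>P\<close> it does not depend on \<open>\<eta>\<close>, which may therefore tend to 0
    at the end.\<close>
  define P' where "P' = 2 * N * inverse (s\<^sup>2) ^ (N + 1) * s"
  have P': "P' > 0" using N s by (simp add: P'_def)
  have key: "- c \<le> \<eta> * P * P'" if \<eta>: "\<eta> > 0" for \<eta>
  proof -
    obtain \<rho>0 where \<rho>0: "\<rho>0 > 0" "\<And>x. x \<in> \<Omega> \<Longrightarrow> norm x \<le> \<rho>0 \<Longrightarrow> u x \<le> \<eta> * x $ k"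
      using cone_sub_sublinear[OF dim cone half q(1,2) C(2) less_imp_le[OF C(1)] M \<eta>] by metis
    define \<rho> where "\<rho> = min (\<rho>0 / Q) (\<eta> * c1 / C)"
    have \<rho>: "\<rho> > 0" using \<rho>0 Q \<eta> c1 C by (simp add: \<rho>_def)
    have "\<rho> \<le> \<rho>0 / Q" "\<rho> \<le> \<eta> * c1 / C" by (auto simp: \<rho>_def)
    then have \<rho>Q: "\<rho> * Q \<le> \<rho>0" and \<rho>C: "\<rho> * C \<le> \<eta> * c1"
      using Q C(1) by (auto simp: pos_le_divide_eq)
    define v where "v = (\<lambda>x. u (\<rho> *\<^sub>R x) / \<rho>)"
    have v: "cone_sub \<Omega> (\<rho> * C) v" unfolding v_def by (rule cone_sub_scale[OF cone \<rho> C(2)])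
    have vb: "v x \<le> \<eta> * Q" if x: "x \<in> \<Omega>" "norm x \<le> Q" for x
    proof -
      have "\<rho> * norm x \<le> \<rho> * Q" using x(2) \<rho> by (intro mult_left_mono) auto
      moreover have "norm (\<rho> *\<^sub>R x) = \<rho> * norm x" using \<rho> by simp
      ultimately have "norm (\<rho> *\<^sub>R x) \<le> \<rho>0" using \<rho>Q by linarith
      then have "u (\<rho> *\<^sub>R x) \<le> \<eta> * (\<rho> * x $ k)"
        using \<rho>0(2)[of "\<rho> *\<^sub>R x"] open_cone_scale[OF cone \<rho>] x(1) by simp
      then have "v x \<le> \<eta> * x $ k" using \<rho> by (simp add: v_def field_simps)
      also have "\<dots> \<le> \<eta> * Q"
        using \<eta> component_le_norm_cart[of x k] x(2) by (intro mult_left_mono) auto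
      finally show ?thesis .
    qed
    define D where "D = \<Omega> \<inter> ball q (2 * s)"
    have inQ: "norm x \<le> Q" if "dist q x \<le> 2 * s" for x
      using that norm_triangle_ineq2[of x q] by (simp add: Q_def dist_norm norm_minus_commute)
    have comp: "v x \<le> (\<eta> * P) * F x" if x: "x \<in> D" for x
    proof (rule visc_comparison[where D = D and \<Omega> = \<Omega> and C = "\<rho> * C" and z = "\<lambda>x. (\<eta> * P) * F x"])
      show "open D" "bounded D" "D \<subseteq> \<Omega>" using op by (auto simp: D_def bounded_Int)
      show "visc_sub \<Omega> (\<rho> * C) v" "continuous_on (closure \<Omega> - {0}) v" using v by (auto simp: cone_sub_def)
      have "closure D \<subseteq> closure \<Omega>" by (intro closure_mono) (simp add: D_def)
      then have "norm (w - q) \<noteq> 0" if "w \<in> closure D" for w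
        using away[of w] that s by auto
      then show "continuous_on (closure D - {0}) (\<lambda>x. (\<eta> * P) * F x)"
        unfolding F_def by (intro continuous_intros) auto
      show "0 \<notin> D" using zero_notin by (simp add: D_def)
      show "\<exists>r>0. \<forall>w\<in>D. norm w < r \<longrightarrow> v w - (\<eta> * P) * F w \<le> \<delta>" for \<delta>
      proof (intro exI[of _ "norm q - 2 * s"] conjI ballI impI)
        fix w assume "w \<in> D" "norm w < norm q - 2 * s"
        then show "v w - (\<eta> * P) * F w \<le> \<delta>"
          using norm_triangle_ineq2[of q w] by (auto simp: D_def dist_norm)
      qed (use s in simp)
      show "\<exists>d l. has_lap (\<lambda>x. (\<eta> * P) * F x) w d l \<and> l \<le> - (\<rho> * C)" if w: "w \<in> D" for w
      proof -
        have wc: "w \<in> closure \<Omega>" using w closure_subset by (auto simp: D_def)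
        have "w \<noteq> q" using away[OF wc] s by auto
        then obtain d where "has_lap (\<lambda>x. inverse ((norm (x - q))\<^sup>2) ^ N) w d
            (cN * inverse ((norm (w - q))\<^sup>2) ^ (N + 1))"
          unfolding cN_def using has_lap_inv_pow by blast
        from has_lap_cmult[OF has_lap_diff[OF has_lap_const this], of "\<eta> * P" "inverse (s\<^sup>2) ^ N"]
        obtain e where "has_lap (\<lambda>x. (\<eta> * P) * F x) w e
            ((\<eta> * P) * (0 - cN * inverse ((norm (w - q))\<^sup>2) ^ (N + 1)))"
          unfolding F_def by blast
        moreover have "inverse ((2 * s)\<^sup>2) ^ (N + 1) \<le> inverse ((norm (w - q))\<^sup>2) ^ (N + 1)"
          using w away[OF wc] s \<open>w \<noteq> q\<close>
          by (intro power_mono le_imp_inverse_le) (auto simp: D_def dist_norm norm_minus_commute)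
        then have "(\<eta> * P) * (cN * inverse ((2 * s)\<^sup>2) ^ (N + 1)) \<le>
            (\<eta> * P) * (cN * inverse ((norm (w - q))\<^sup>2) ^ (N + 1))"
          using \<eta> P cN by (intro mult_left_mono) auto
        then have "\<rho> * C \<le> (\<eta> * P) * (cN * inverse ((norm (w - q))\<^sup>2) ^ (N + 1))"
          using \<rho>C by (simp add: c1_def mult.assoc)
        ultimately show ?thesis by (intro exI conjI) (assumption, simp)
      qed
      show "v w \<le> (\<eta> * P) * F w" if w: "w \<in> frontier D" "w \<noteq> 0" for w
      proof -
        note fr = frontier_Int_ball_cases[OF op, of w q "2 * s", folded D_def, OF w(1)]
        from fr(3) show ?thesis
        proof
          assume "w \<in> frontier \<Omega>"
          then have "v w \<le> 0" using v w(2) by (auto simp: cone_sub_def)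
          moreover have "(\<eta> * P) * F w \<ge> 0" using \<eta> P F0[OF fr(1)] by simp
          ultimately show ?thesis by simp
        next
          assume a: "w \<in> \<Omega> \<and> dist q w = 2 * s"
          then have "F w = F2" by (simp add: F_def F2_def dist_norm norm_minus_commute)
          then have "(\<eta> * P) * F w = \<eta> * Q" using F2 by (simp add: P_def)
          moreover have "v w \<le> \<eta> * Q" using vb[of w] a inQ[of w] by simp
          ultimately show ?thesis by (simp only:)
        qed
      qed
    qed (rule x)
    have \<rho>y: "\<rho> *\<^sub>R y \<in> frontier \<Omega>" "\<rho> *\<^sub>R y \<noteq> 0"
      using y(1,2) \<rho> open_cone_scale[OF cone \<rho>] open_cone_closure_scale[OF cone \<rho>]
      by (auto simp: frontier_iff)
    obtain \<nu> where \<nu>: "norm \<nu> = 1" "G (\<rho> *\<^sub>R y) \<bullet> \<nu> = c"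
      "\<And>d. \<nu> \<bullet> d < 0 \<Longrightarrow> \<exists>t0>0. \<forall>t. 0 < t \<and> t < t0 \<longrightarrow> \<rho> *\<^sub>R y + t *\<^sub>R d \<in> \<Omega>"
      using normal_exists[OF \<rho>y] by metis
    define d where "d = - \<nu>"
    have "\<nu> \<bullet> d < 0" using \<nu>(1) by (simp add: d_def dot_square_norm)
    then obtain t0 where t0: "t0 > 0" "\<And>t. 0 < t \<Longrightarrow> t < t0 \<Longrightarrow> \<rho> *\<^sub>R y + t *\<^sub>R d \<in> \<Omega>" using \<nu>(3) by blast
    have L1: "((\<lambda>t. u (\<rho> *\<^sub>R y + t *\<^sub>R d) / t) \<longlongrightarrow> G (\<rho> *\<^sub>R y) \<bullet> d) (at_right 0)"
      by (rule quotient_tendsto[OF \<rho>y t0])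
    \<comment> \<open>The barrier carried back to \<open>u\<close> along the normal line at
      \<open>\<rho> *\<^sub>R y\<close>: time t there is time t / \<rho> for the dilated
      function.\<close>
    define \<psi> where "\<psi> = (\<lambda>t. (\<rho> * \<eta> * P) * (inverse (s\<^sup>2) ^ N - inverse ((norm ((y - q) + t *\<^sub>R (d /\<^sub>R \<rho>)))\<^sup>2) ^ N))"
    have "y - q \<noteq> 0" using yq s by auto
    from DERIV_cmult[OF DERIV_diff[OF DERIV_const DERIV_inv_pow_line[OF this, of "d /\<^sub>R \<rho>" N]],
        of "\<rho> * \<eta> * P" "inverse (s\<^sup>2) ^ N", folded \<psi>_def]
    have "(\<psi> has_real_derivative (\<eta> * P) * (2 * N * inverse (s\<^sup>2) ^ (N + 1) * ((y - q) \<bullet> d))) (at 0)"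
      by (rule DERIV_cong) (use \<rho> in \<open>simp add: yq\<close>)
    moreover have "\<psi> 0 = 0" by (simp add: \<psi>_def yq)
    ultimately have L2: "((\<lambda>t. \<psi> t / t) \<longlongrightarrow> (\<eta> * P) * (2 * N * inverse (s\<^sup>2) ^ (N + 1) * ((y - q) \<bullet> d))) (at_right 0)"
      by (rule DERIV_right_quotient)
    have "u (\<rho> *\<^sub>R y + t *\<^sub>R d) / t \<le> \<psi> t / t" if t: "0 < t" "t < min t0 (\<rho> * s)" for t
    proof -
      define x where "x = y + (t / \<rho>) *\<^sub>R d"
      have xe: "\<rho> *\<^sub>R x = \<rho> *\<^sub>R y + t *\<^sub>R d" using \<rho> by (simp add: x_def scaleR_add_right)
      have "\<rho> *\<^sub>R x \<in> \<Omega>" using t0(2)[of t] t xe by simp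
      then have xO: "x \<in> \<Omega>" using open_cone_scale[OF cone \<rho>] by simp
      have "norm (x - q) \<le> norm (y - q) + norm ((t / \<rho>) *\<^sub>R d)"
        using norm_triangle_ineq[of "y - q" "(t / \<rho>) *\<^sub>R d"] by (simp add: x_def algebra_simps)
      also have "\<dots> = s + t / \<rho>" using \<nu>(1) t \<rho> by (simp add: yq d_def)
      also have "\<dots> < 2 * s" using t \<rho> by (simp add: pos_divide_less_eq mult.commute)
      finally have "x \<in> D" using xO by (simp add: D_def dist_norm norm_minus_commute)
      then have "u (\<rho> *\<^sub>R x) \<le> \<rho> * ((\<eta> * P) * F x)"
        using comp[of x] \<rho> by (simp add: v_def pos_divide_le_eq mult.commute)
      also have "\<rho> * ((\<eta> * P) * F x) = \<psi> t"
        using \<rho> by (simp add: \<psi>_def F_def x_def divide_inverse algebra_simps)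
      finally show ?thesis using t(1) xe by (simp add: divide_right_mono)
    qed
    then have "\<forall>\<^sub>F t in at_right 0. u (\<rho> *\<^sub>R y + t *\<^sub>R d) / t \<le> \<psi> t / t"
      unfolding eventually_at_right_field using t0(1) \<rho> s(1)
      by (intro exI[of _ "min t0 (\<rho> * s)"]) auto
    then have "G (\<rho> *\<^sub>R y) \<bullet> d \<le> (\<eta> * P) * (2 * N * inverse (s\<^sup>2) ^ (N + 1) * ((y - q) \<bullet> d))"
      by (rule tendsto_le[OF trivial_limit_at_right_real L2 L1])
    also have "(y - q) \<bullet> d \<le> s"
      using norm_cauchy_schwarz[of "y - q" d] yq \<nu>(1) by (simp add: d_def)
    then have "(\<eta> * P) * (2 * N * inverse (s\<^sup>2) ^ (N + 1) * ((y - q) \<bullet> d)) \<le> (\<eta> * P) * P'"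
      unfolding P'_def using \<eta> P by (intro mult_left_mono) auto
    finally show ?thesis using \<nu>(2) by (simp add: d_def)
  qed
  have "- c \<le> 0 + \<epsilon>" if "\<epsilon> > 0" for \<epsilon>
    using key[of "\<epsilon> / (P * P')"] that P P' by simp
  then have "- c \<le> 0" by (rule field_le_epsilon)
  then show ?thesis by simp
qed

text \<open>With \<open>f 0 \<ge> 0\<close> the Lipschitz bound gives laplace u <= L u. A radial
  power of high exponent satisfies the opposite strict inequality on an annulus and has positive
  inward slope on the outer sphere; comparison transfers that slope to \<open>u\<close>.\<close>

lemma hopf:
  assumes f0: "f 0 \<ge> 0" and y: "y \<in> frontier \<Omega>"
    and s: "dist q y > 0" "norm q > dist q y" "ball q (dist q y) \<subseteq> \<Omega>"
  shows "G y \<bullet> (q - y) > 0"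
proof -
  define s where "s = dist q y"
  have s: "s > 0" "norm q > s" "ball q s \<subseteq> \<Omega>" using s by (auto simp: s_def)
  have yq: "norm (y - q) = s" by (simp add: s_def dist_norm norm_minus_commute)
  have y0: "y \<noteq> 0" using yq s by auto
  have "closure (ball q s) \<subseteq> closure \<Omega>" using s(3) by (rule closure_mono)
  then have "cball q s \<subseteq> closure \<Omega>" using s(1) by simp
  moreover have "0 \<notin> cball q s" using s(2) by simp
  ultimately have cb: "cball q s \<subseteq> closure \<Omega> - {0}" by blast
  have u0: "u x \<ge> 0" if "x \<in> cball q s" for x
  proof (cases "x \<in> \<Omega>")
    case False
    have "x \<in> closure \<Omega> - {0}" using that cb by blast
    then show ?thesis using False dirichlet[of x] by (simp add: frontier_iff)
  qed (use pos in \<open>simp add: less_imp_le\<close>)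
  obtain M where M: "\<And>x. x \<in> \<Omega> \<Longrightarrow> u x \<le> M" "M \<ge> 0" using u_bound by blast
  obtain L where L: "L \<ge> 0" "\<And>a b. 0 \<le> a \<Longrightarrow> a \<le> M \<Longrightarrow> 0 \<le> b \<Longrightarrow> b \<le> M \<Longrightarrow> \<bar>f a - f b\<bar> \<le> L * \<bar>a - b\<bar>"
    using f_lipschitz by blast
  have fL: "- f (u x) \<le> L * u x" if "x \<in> \<Omega>" for x
    using L(2)[of "u x" 0] M pos[OF that] that f0 by (simp add: abs_le_iff)
  \<comment> \<open>The exponent has to beat the zeroth-order term: N > (L + 1) s^2 yields cN >= (L
    + 1) s^2, and adding n keeps 2 N + 2 - n positive.\<close>
  obtain N0 :: nat where N0: "real N0 > (L + 1) * s\<^sup>2" using reals_Archimedean2 by blast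
  define N where "N = N0 + CARD('n)"
  define cN where "cN = 2 * real N * (2 * real N + 2 - real CARD('n))"
  have N: "N > 0" by (simp add: N_def)
  have "(L + 1) * s\<^sup>2 \<le> real N" using N0 by (simp add: N_def)
  also have "\<dots> \<le> real N * (2 * (2 * real N + 2 - real CARD('n)))"
    using mult_left_mono[of 1 "2 * (2 * real N + 2 - real CARD('n))" "real N"] by (simp add: N_def)
  finally have cN: "(L + 1) * s\<^sup>2 \<le> cN" by (simp add: cN_def mult_ac)
  define b where "b = (\<lambda>x. inverse ((norm (x - q))\<^sup>2) ^ N - inverse (s\<^sup>2) ^ N)"
  have bpos: "b x > 0" if "x \<noteq> q" "norm (x - q) < s" for x
  proof -
    have "inverse (s\<^sup>2) < inverse ((norm (x - q))\<^sup>2)"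
      using that s(1) by (intro less_imp_inverse_less power_strict_mono) auto
    then have "inverse (s\<^sup>2) ^ N < inverse ((norm (x - q))\<^sup>2) ^ N"
      using N s(1) by (intro power_strict_mono) auto
    then show ?thesis by (simp add: b_def)
  qed
  have blap: "\<exists>d l. has_lap b x d l \<and> l > L * b x" if x: "x \<noteq> q" "norm (x - q) < s" for x
  proof -
    define i where "i = inverse ((norm (x - q))\<^sup>2)"
    have "(norm (x - q))\<^sup>2 > 0" using x by simp
    then have i: "i > 0" by (simp add: i_def)
    have "has_lap b x ((- (N * i ^ (N + 1))) *\<^sub>R 2 *\<^sub>R (x - q) - 0) (cN * i ^ (N + 1) - 0)"
      unfolding b_def i_def cN_def by (intro has_lap_diff has_lap_inv_pow has_lap_const x)
    moreover have "cN * i ^ (N + 1) - 0 > L * b x"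
    proof -
      \<comment> \<open>Inside the ball s^2 i >= 1, so b <= i^N <= s^2 i^(N+1), and i^(N+1) is the
        power occurring in the Laplacian of \<open>b\<close>.\<close>
      have "(norm (x - q))\<^sup>2 \<le> s\<^sup>2" using x s(1) by (intro power_mono) auto
      then have "1 \<le> s\<^sup>2 * i" using \<open>(norm (x - q))\<^sup>2 > 0\<close>
        by (simp add: i_def divide_inverse[symmetric])
      have "L * b x < (L + 1) * b x" using bpos[OF x] by (simp add: algebra_simps)
      also have "\<dots> \<le> (L + 1) * (1 * i ^ N)" using L s(1) by (intro mult_left_mono) (auto simp: b_def i_def)
      also have "\<dots> \<le> (L + 1) * ((s\<^sup>2 * i) * i ^ N)"
        using L i \<open>1 \<le> s\<^sup>2 * i\<close> by (intro mult_left_mono mult_right_mono) auto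
      also have "\<dots> = ((L + 1) * s\<^sup>2) * i ^ (N + 1)" by simp
      also have "\<dots> \<le> cN * i ^ (N + 1)" using cN i by (intro mult_right_mono) auto
      finally show ?thesis by simp
    qed
    ultimately show ?thesis by blast
  qed
  have "compact (sphere q (s/2))" by simp
  moreover have "sphere q (s/2) \<noteq> {}" using s(1) by simp
  moreover have sph: "sphere q (s/2) \<subseteq> \<Omega>" using s by auto
  have "continuous_on (sphere q (s/2)) u"
    using sph subset_closure by (intro continuous_on_subset[OF cu]) blast
  ultimately obtain x0 where x0: "x0 \<in> sphere q (s/2)" "\<And>x. x \<in> sphere q (s/2) \<Longrightarrow> u x0 \<le> u x"
    using continuous_attains_inf by metis
  have m0: "u x0 > 0" using x0(1) sph pos by blast
  define B where "B = inverse ((s/2)\<^sup>2) ^ N - inverse (s\<^sup>2) ^ N"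
  have "norm (x0 - q) = s/2" using x0(1) by (simp add: dist_norm norm_minus_commute)
  then have B: "B > 0" using bpos[of x0] s(1) by (auto simp: b_def B_def)
  \<comment> \<open>Makes \<epsilon> b equal to the minimum of \<open>u\<close> on the inner sphere;
    on the outer sphere \<open>b\<close> is 0.\<close>
  define \<epsilon> where "\<epsilon> = u x0 / B"
  have \<epsilon>: "\<epsilon> > 0" using m0 B by (simp add: \<epsilon>_def)
  define K where "K = cball q s - ball q (s/2)"
  have K: "compact K" unfolding K_def by (intro compact_diff) auto
  have Kq: "s/2 \<le> norm (x - q) \<and> norm (x - q) \<le> s" if "x \<in> K" for x
    using that by (auto simp: K_def dist_norm norm_minus_commute)
  have Kne: "x \<noteq> q" if "x \<in> K" for x using Kq[OF that] s(1) by auto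
  have cK: "continuous_on K (\<lambda>x. \<epsilon> * b x - u x)"
  proof (intro continuous_on_diff continuous_on_mult_left)
    show "continuous_on K b" unfolding b_def using Kne by (intro continuous_intros) auto
    show "continuous_on K u" using cb by (intro continuous_on_subset[OF cu]) (auto simp: K_def)
  qed
  have main: "\<epsilon> * b x \<le> u x" if x: "x \<in> K" for x
  proof (rule ccontr)
    assume "\<not> ?thesis"
    then have neg: "\<epsilon> * b x - u x > 0" by simp
    obtain z where z: "z \<in> K" "\<And>w. w \<in> K \<Longrightarrow> \<epsilon> * b w - u w \<le> \<epsilon> * b z - u z"
      using continuous_attains_sup[OF K _ cK] x by blast
    have zpos: "\<epsilon> * b z > u z" using z(2)[OF x] neg by linarith
    have uz: "u z \<ge> 0" using z(1) by (intro u0) (auto simp: K_def)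
    have "norm (z - q) \<noteq> s"
      using zpos uz by (auto simp: b_def)
    moreover have "norm (z - q) \<noteq> s/2"
    proof
      assume a: "norm (z - q) = s/2"
      have "b z = B" unfolding b_def B_def a by (rule refl)
      then have "\<epsilon> * b z = u x0" using B by (simp add: \<epsilon>_def)
      moreover have "u x0 \<le> u z" using a by (intro x0(2)) (simp add: dist_norm norm_minus_commute)
      ultimately show False using zpos by simp
    qed
    ultimately have zz: "s/2 < norm (z - q)" "norm (z - q) < s" using Kq[OF z(1)] by auto
    have "open (ball q s - cball q (s/2))" by (intro open_Diff) auto
    moreover have "z \<in> ball q s - cball q (s/2)" using zz by (simp add: dist_norm norm_minus_commute)
    ultimately obtain r where r: "r > 0" "ball z r \<subseteq> ball q s - cball q (s/2)" using openE by blast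
    then have rK: "ball z r \<subseteq> K" by (auto simp: K_def)
    have zO: "z \<in> \<Omega>" using zz s(3) by (auto simp: dist_norm norm_minus_commute)
    \<comment> \<open>At a positive interior maximum of \<epsilon> b - u one would have \<epsilon>
      laplace b > L \<epsilon> b >= L u >= laplace u.\<close>
    obtain d l where l: "has_lap b z d l" "l > L * b z" using blap[OF Kne[OF z(1)] zz(2)] by blast
    have "\<epsilon> * l - (- f (u z)) \<le> 0"
      by (rule has_lap_local_max[OF has_lap_diff[OF has_lap_cmult[OF l(1)] lap_u[OF zO]] r(1)])
        (use z(2) rK in blast)
    moreover have "\<epsilon> * l > \<epsilon> * (L * b z)" using l(2) \<epsilon> by simp
    moreover have "L * u z \<le> L * (\<epsilon> * b z)" using zpos L(1) by (intro mult_left_mono) auto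
    ultimately show False using fL[OF zO] by (simp add: mult.left_commute)
  qed
  define d where "d = q - y"
  have nd: "norm d = s" using yq by (simp add: d_def norm_minus_commute)
  have line: "norm ((y + t *\<^sub>R d) - q) = (1 - t) * s" if "0 \<le> t" "t \<le> 1" for t
  proof -
    have "(y + t *\<^sub>R d) - q = (1 - t) *\<^sub>R (y - q)" by (simp add: d_def algebra_simps)
    then show ?thesis using that yq by simp
  qed
  have lO: "y + t *\<^sub>R d \<in> \<Omega>" if "0 < t" "t < 1" for t
    using line[of t] that s(1,3) by (auto simp: dist_norm norm_minus_commute subset_iff)
  have L1: "((\<lambda>t. u (y + t *\<^sub>R d) / t) \<longlongrightarrow> G y \<bullet> d) (at_right 0)"
    by (rule quotient_tendsto[OF y y0 zero_less_one lO])
  define \<psi> where "\<psi> = (\<lambda>t. \<epsilon> * (inverse ((norm ((y - q) + t *\<^sub>R d))\<^sup>2) ^ N - inverse (s\<^sup>2) ^ N))"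
  have "y - q \<noteq> 0" using yq s by auto
  note D = DERIV_cmult[OF DERIV_diff[OF DERIV_inv_pow_line[OF this, of d N] DERIV_const],
      of \<epsilon> "inverse (s\<^sup>2) ^ N", folded \<psi>_def]
  have "d = - (y - q)" by (simp add: d_def)
  then have "(y - q) \<bullet> d = - s\<^sup>2" by (simp only: inner_minus_right dot_square_norm yq)
  then have "(\<psi> has_real_derivative \<epsilon> * (N * inverse (s\<^sup>2) ^ (N + 1) * (2 * s\<^sup>2))) (at 0)"
    using D unfolding yq by (elim DERIV_cong) simp
  moreover have "\<psi> 0 = 0" by (simp add: \<psi>_def yq)
  ultimately have L2: "((\<lambda>t. \<psi> t / t) \<longlongrightarrow> \<epsilon> * (N * inverse (s\<^sup>2) ^ (N + 1) * (2 * s\<^sup>2))) (at_right 0)"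
    by (rule DERIV_right_quotient)
  have "\<psi> t / t \<le> u (y + t *\<^sub>R d) / t" if t: "0 < t" "t < 1/2" for t
  proof -
    have "s / 2 \<le> (1 - t) * s" "(1 - t) * s \<le> s" using t s(1) by (auto simp: field_simps)
    then have "y + t *\<^sub>R d \<in> K"
      using line[of t] t by (auto simp: K_def dist_norm norm_minus_commute)
    from main[OF this] have "\<psi> t \<le> u (y + t *\<^sub>R d)"
      unfolding \<psi>_def b_def by (simp only: diff_add_eq)
    then show ?thesis using t(1) by (simp add: divide_right_mono)
  qed
  then have "\<forall>\<^sub>F t in at_right 0. \<psi> t / t \<le> u (y + t *\<^sub>R d) / t"
    unfolding eventually_at_right_field by (intro exI[of _ "1/2"]) auto
  then have "\<epsilon> * (N * inverse (s\<^sup>2) ^ (N + 1) * (2 * s\<^sup>2)) \<le> G y \<bullet> d"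
    by (rule tendsto_le[OF trivial_limit_at_right_real L1 L2])
  moreover have "\<epsilon> * (N * inverse (s\<^sup>2) ^ (N + 1) * (2 * s\<^sup>2)) > 0" using \<epsilon> N s(1) by simp
  ultimately have "G y \<bullet> d > 0" by linarith
  then show ?thesis by (simp add: d_def)
qed

text \<open>If f(0) < 0, a positive lower bound on laplace u makes \<open>u\<close> rise by \<kappa>
  (\<rho> s)^2 within a ball of radius \<rho> s near the vertex, whereas the gradient decay allows
  only a small multiple of \<rho>^2. Both sides are quadratic in \<rho>, so smallness of
  \<open>\<eta>\<close> decides.\<close>

lemma f_zero_nonneg:
  assumes c: "c = 0" and p: "p \<in> frontier \<Omega>" "p $ k > 0"
  shows "f 0 \<ge> 0"
proof (rule ccontr)
  assume "\<not> f 0 \<ge> 0"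
  define \<mu> where "\<mu> = - f 0 / 2"
  have \<mu>: "\<mu> > 0" using \<open>\<not> f 0 \<ge> 0\<close> by (simp add: \<mu>_def)
  obtain q where q: "q $ k > 0" "q \<notin> closure \<Omega>"
    using exterior_point[OF p] by metis
  obtain Mu where Mu: "\<And>x. x \<in> \<Omega> \<Longrightarrow> u x \<le> Mu" using u_bound by metis
  obtain M where M: "\<And>x. x \<in> \<Omega> \<Longrightarrow> norm (G x) \<le> M" using G_bound by blast
  obtain L where L: "L \<ge> 0" "\<And>a b. 0 \<le> a \<Longrightarrow> a \<le> Mu \<Longrightarrow> 0 \<le> b \<Longrightarrow> b \<le> Mu \<Longrightarrow> \<bar>f a - f b\<bar> \<le> L * \<bar>a - b\<bar>"
    using f_lipschitz by blast
  have lip: "\<bar>- f (u x) - - f (u y)\<bar> \<le> L * \<bar>u x - u y\<bar>" if "x \<in> \<Omega>" "y \<in> \<Omega>" for x y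
    using L(2)[of "u x" "u y"] Mu pos that by (simp add: less_imp_le abs_minus_commute)
  define C where "C = \<bar>L * M\<bar> + 1"
  have C: "C > L * M" "C \<ge> 0" by (auto simp: C_def)
  \<comment> \<open>The vanishing of the whole gradient on the boundary gives every directional
    derivative the boundary values of a subsolution.\<close>
  have dsub: "cone_sub \<Omega> C (\<lambda>x. G x \<bullet> e)" if e: "norm e = 1" for e
    unfolding cone_sub_def
  proof (intro conjI ballI)
    show "continuous_on (closure \<Omega> - {0}) (\<lambda>x. G x \<bullet> e)" by (intro continuous_intros cG)
    show "G p \<bullet> e \<le> 0" if "p \<in> frontier \<Omega> - {0}" for p using gradient_zero[OF c] that by auto
    show "visc_sub \<Omega> C (\<lambda>x. G x \<bullet> e)"
      by (rule visc_sub_directional_derivative[OF op continuous_on_subset[OF cG subset_closure]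
            du lap_u M lip L(1) e C(1)])
  qed
  have small: "\<exists>\<rho>>0. \<forall>x\<in>\<Omega>. norm x \<le> \<rho> \<longrightarrow> G x \<bullet> e \<le> \<eta> * norm x" if e: "norm e = 1" and \<eta>: "\<eta> > 0" for e \<eta>
  proof -
    have "G x \<bullet> e \<le> M" if "x \<in> \<Omega>" for x
      using norm_cauchy_schwarz[of "G x" e] M[OF that] e by simp
    then obtain \<rho> where \<rho>: "\<rho> > 0" "\<And>x. x \<in> \<Omega> \<Longrightarrow> norm x \<le> \<rho> \<Longrightarrow> G x \<bullet> e \<le> \<eta> * x $ k"
      using cone_sub_sublinear[OF dim cone half q dsub[OF e] C(2) _ \<eta>] by metis
    have "\<eta> * x $ k \<le> \<eta> * norm x" for x
      using \<eta> component_le_norm_cart[of x k] by (intro mult_left_mono) auto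
    then show ?thesis using \<rho> by (meson order_trans)
  qed
  have Gsmall: "\<exists>\<rho>>0. \<forall>x\<in>\<Omega>. norm x \<le> \<rho> \<longrightarrow> norm (G x) \<le> CARD('n) * (\<eta> * norm x)" if \<eta>: "\<eta> > 0" for \<eta>
  proof -
    have "\<forall>i. \<exists>\<rho>>0. \<forall>x\<in>\<Omega>. norm x \<le> \<rho> \<longrightarrow> \<bar>G x $ i\<bar> \<le> \<eta> * norm x"
    proof
      fix i
      \<comment> \<open>The decay theorem bounds from above only, so both the axis direction and its
        negative are needed.\<close>
      have "norm (axis i 1 :: real^'n) = 1" "norm (- axis i 1 :: real^'n) = 1" by simp_all
      from small[OF this(1) \<eta>] small[OF this(2) \<eta>] obtain r1 r2 where
        "r1 > 0" "\<forall>x\<in>\<Omega>. norm x \<le> r1 \<longrightarrow> G x \<bullet> axis i 1 \<le> \<eta> * norm x"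
        "r2 > 0" "\<forall>x\<in>\<Omega>. norm x \<le> r2 \<longrightarrow> G x \<bullet> - axis i 1 \<le> \<eta> * norm x" by blast
      then show "\<exists>\<rho>>0. \<forall>x\<in>\<Omega>. norm x \<le> \<rho> \<longrightarrow> \<bar>G x $ i\<bar> \<le> \<eta> * norm x"
        by (intro exI[of _ "min r1 r2"]) (auto simp: inner_axis abs_le_iff)
    qed
    then obtain R where R: "\<And>i. R i > 0" "\<And>i x. x \<in> \<Omega> \<Longrightarrow> norm x \<le> R i \<Longrightarrow> \<bar>G x $ i\<bar> \<le> \<eta> * norm x"
      by metis
    show ?thesis
    proof (intro exI[of _ "Min (range R)"] conjI ballI impI)
      show "Min (range R) > 0" using R(1) by simp
      fix x assume x: "x \<in> \<Omega>" "norm x \<le> Min (range R)"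
      have "norm (G x) \<le> (\<Sum>i\<in>UNIV. \<bar>G x $ i\<bar>)" by (rule norm_le_l1_cart)
      also have "\<dots> \<le> (\<Sum>i\<in>(UNIV::'n set). \<eta> * norm x)"
        using R(2)[OF x(1)] x(2) by (intro sum_mono) simp
      finally show "norm (G x) \<le> CARD('n) * (\<eta> * norm x)" by simp
    qed
  qed
  obtain a where a: "a \<in> \<Omega>" using cone by (auto simp: open_cone_def)
  obtain s where s: "s > 0" "cball a s \<subseteq> \<Omega>" using op a open_contains_cball by blast
  define n where "n = real CARD('n)"
  have n: "n > 0" by (simp add: n_def)
  define T where "T = norm a + s"
  have T: "T > 0" using s(1) by (simp add: T_def add_nonneg_pos)
  \<comment> \<open>Over the distance \<rho> s the gradient bound then gives exactly half of
    \<kappa> (\<rho> s)^2; \<open>T\<close> bounds the norm on \<open>cball a s\<close>.\<close>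
  define \<eta> where "\<eta> = \<mu> * s / (8 * n * n * T)"
  have \<eta>: "\<eta> > 0" using \<mu> s n T by (simp add: \<eta>_def)
  obtain \<rho>1 where \<rho>1: "\<rho>1 > 0" "\<And>x. x \<in> \<Omega> \<Longrightarrow> norm x \<le> \<rho>1 \<Longrightarrow> norm (G x) \<le> n * (\<eta> * norm x)"
    using Gsmall[OF \<eta>] unfolding n_def by blast
  have "isCont f 0" using df DERIV_isCont by blast
  then obtain \<delta> where \<delta>: "\<delta> > 0" "\<And>t. \<bar>t\<bar> < \<delta> \<Longrightarrow> \<bar>f t - f 0\<bar> < \<mu>"
    using \<mu> unfolding continuous_at_eps_delta dist_real_def by (metis diff_zero)
  obtain C' where C': "C' > 0" "cone_sub \<Omega> C' u" using cone_sub_u by blast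
  obtain \<rho>2 where \<rho>2: "\<rho>2 > 0" "\<And>x. x \<in> \<Omega> \<Longrightarrow> norm x \<le> \<rho>2 \<Longrightarrow> u x \<le> 1 * x $ k"
    using cone_sub_sublinear[OF dim cone half q C'(2) less_imp_le[OF C'(1)] Mu zero_less_one] by metis
  \<comment> \<open>Points of the dilated ball have norm at most \<rho> T. There the gradient bound
    holds, and u <= x_k puts \<open>u\<close> below \<open>\<delta>\<close>, so that f(u) stays near
    f(0).\<close>
  define \<rho> where "\<rho> = min \<rho>1 (min \<rho>2 (\<delta> / 2)) / T"
  have \<rho>: "\<rho> > 0" using \<rho>1 \<rho>2 \<delta> T by (simp add: \<rho>_def)
  have "\<rho> * T = min \<rho>1 (min \<rho>2 (\<delta> / 2))" using T by (simp add: \<rho>_def)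
  then have \<rho>T: "\<rho> * T \<le> \<rho>1" "\<rho> * T \<le> \<rho>2" "\<rho> * T < \<delta>" using \<delta>(1) by auto
  define B where "B = cball (\<rho> *\<^sub>R a) (\<rho> * s)"
  have nB: "norm x \<le> \<rho> * T" if "x \<in> B" for x
    using that norm_triangle_ineq2[of x "\<rho> *\<^sub>R a"] \<rho>
    by (simp add: B_def T_def dist_norm norm_minus_commute algebra_simps)
  have BO: "B \<subseteq> \<Omega>"
  proof
    fix x assume "x \<in> B"
    then have "norm (\<rho> *\<^sub>R a - x) \<le> \<rho> * s" by (simp add: B_def dist_norm)
    moreover have "\<rho> *\<^sub>R a - x = \<rho> *\<^sub>R (a - inverse \<rho> *\<^sub>R x)" using \<rho> by (simp add: algebra_simps)
    ultimately have "\<rho> * norm (a - inverse \<rho> *\<^sub>R x) \<le> \<rho> * s" using \<rho> by simp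
    then have "inverse \<rho> *\<^sub>R x \<in> cball a s" using \<rho> by (simp add: dist_norm)
    then have "inverse \<rho> *\<^sub>R x \<in> \<Omega>" using s(2) by blast
    then show "x \<in> \<Omega>" using open_cone_scale[OF cone, of "inverse \<rho>" x] \<rho> by simp
  qed
  have lap_big: "- f (u x) > \<mu>" if "x \<in> B" for x
  proof -
    have x: "x \<in> \<Omega>" "norm x \<le> \<rho> * T" using that BO nB by auto
    have "u x \<le> norm x" using \<rho>2(2)[of x] x \<rho>T component_le_norm_cart[of x k] by simp
    then have "\<bar>u x\<bar> < \<delta>" using pos[OF x(1)] x \<rho>T by simp
    then show ?thesis using \<delta>(2)[of "u x"] \<mu> by (auto simp: \<mu>_def abs_less_iff)
  qed
  have Gb: "norm (G x) \<le> n * \<eta> * (\<rho> * T)" if "x \<in> B" for x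
  proof -
    have "norm (G x) \<le> n * (\<eta> * norm x)" using \<rho>1(2)[of x] that BO nB[OF that] \<rho>T by auto
    also have "\<dots> \<le> n * (\<eta> * (\<rho> * T))" using nB[OF that] n \<eta> by (intro mult_left_mono) auto
    finally show ?thesis by simp
  qed
  \<comment> \<open>The subtracted quadratic has Laplacian \<mu>/2, so \<open>h\<close> keeps a
    positive Laplacian and attains its maximum on the sphere.\<close>
  define \<kappa> where "\<kappa> = \<mu> / (4 * n)"
  have \<kappa>: "\<kappa> > 0" using \<mu> n by (simp add: \<kappa>_def)
  define h where "h = (\<lambda>x. u x - \<kappa> * (norm (x - \<rho> *\<^sub>R a))\<^sup>2)"
  have "continuous_on B u" using BO subset_closure by (intro continuous_on_subset[OF cu]) auto
  then have "continuous_on B h" unfolding h_def by (intro continuous_intros)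
  moreover have center: "\<rho> *\<^sub>R a \<in> B" using \<rho> s by (simp add: B_def)
  moreover have "compact B" by (simp add: B_def)
  ultimately obtain x1 where x1: "x1 \<in> B" "\<And>y. y \<in> B \<Longrightarrow> h y \<le> h x1"
    using continuous_attains_sup[of B h] by blast
  have "norm (x1 - \<rho> *\<^sub>R a) = \<rho> * s"
  proof (rule ccontr)
    assume "\<not> ?thesis"
    then have "x1 \<in> ball (\<rho> *\<^sub>R a) (\<rho> * s)" using x1(1) by (auto simp: B_def dist_norm norm_minus_commute)
    then obtain r where r: "r > 0" "ball x1 r \<subseteq> ball (\<rho> *\<^sub>R a) (\<rho> * s)" using openE[OF open_ball] by blast
    have "x1 \<in> \<Omega>" using x1(1) BO by blast
    from has_lap_diff[OF lap_u[OF this] has_lap_cmult[OF has_lap_sqdist]]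
    have "has_lap h x1 (G x1 - \<kappa> *\<^sub>R 2 *\<^sub>R (x1 - \<rho> *\<^sub>R a)) (- f (u x1) - \<kappa> * (2 * CARD('n)))"
      unfolding h_def .
    then have "- f (u x1) - \<kappa> * (2 * CARD('n)) \<le> 0"
      by (rule has_lap_local_max[OF _ r(1)]) (use x1(2) r(2) in \<open>auto simp: B_def\<close>)
    moreover have "\<kappa> * (2 * CARD('n)) = \<mu> / 2" using n by (simp add: \<kappa>_def n_def)
    ultimately show False using lap_big[OF x1(1)] \<mu> by simp
  qed
  then have "u (\<rho> *\<^sub>R a) + \<kappa> * (\<rho> * s)\<^sup>2 \<le> u x1"
    using x1(2)[OF center] by (simp add: h_def)
  moreover have "norm (u x1 - u (\<rho> *\<^sub>R a)) \<le> n * \<eta> * (\<rho> * T) * norm (x1 - \<rho> *\<^sub>R a)"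
  proof (rule differentiable_bound[of B u "\<lambda>x h. G x \<bullet> h"])
    show "convex B" by (simp add: B_def)
    fix x assume x: "x \<in> B"
    then show "(u has_derivative (\<lambda>h. G x \<bullet> h)) (at x within B)"
      using BO du has_derivative_at_withinI by blast
    show "onorm (\<lambda>h. G x \<bullet> h) \<le> n * \<eta> * (\<rho> * T)"
    proof (rule onorm_le)
      fix h
      show "norm (G x \<bullet> h) \<le> n * \<eta> * (\<rho> * T) * norm h"
        using Cauchy_Schwarz_ineq2[of "G x" h] mult_right_mono[OF Gb[OF x] norm_ge_zero[of h]] by simp
    qed
  qed (use x1(1) center in auto)
  ultimately have "\<kappa> * (\<rho> * s)\<^sup>2 \<le> n * \<eta> * (\<rho> * T) * (\<rho> * s)"
    using \<open>norm (x1 - \<rho> *\<^sub>R a) = \<rho> * s\<close> by simp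
  moreover have "n * \<eta> * (\<rho> * T) * (\<rho> * s) = (\<mu> / (8 * n)) * (\<rho> * s)\<^sup>2"
    using n T by (simp add: \<eta>_def power2_eq_square field_simps)
  moreover have "\<kappa> * (\<rho> * s)\<^sup>2 = 2 * ((\<mu> / (8 * n)) * (\<rho> * s)\<^sup>2)" by (simp add: \<kappa>_def field_simps)
  moreover have "(\<mu> / (8 * n)) * (\<rho> * s)\<^sup>2 > 0" using \<mu> n \<rho> s by simp
  ultimately show False by linarith
qed

theorem eq_half_space: "\<Omega> = {x. x $ k > 0}"
proof (rule ccontr)
  assume ne: "\<Omega> \<noteq> {x. x $ k > 0}"
  \<comment> \<open>The half-space is connected and meets the cone without being contained in it, so
    it contains a frontier point, necessarily off the hyperplane.\<close>
  have "convex {x::real^'n. x $ k > 0}"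
    using convex_halfspace_gt[of 0 "axis k 1 :: real^'n"] by (simp add: inner_axis')
  moreover have "{x. x $ k > 0} \<inter> \<Omega> \<noteq> {}" using half cone by (auto simp: open_cone_def)
  moreover have "{x. x $ k > 0} - \<Omega> \<noteq> {}" using ne half by blast
  ultimately have "{x. x $ k > 0} \<inter> frontier \<Omega> \<noteq> {}"
    using connected_Int_frontier convex_connected by blast
  then obtain p where p: "p \<in> frontier \<Omega>" "p $ k > 0" by blast
  then have p0: "p \<noteq> 0" by auto
  have c: "c = 0" using neumann_nonpos[OF p(1) p0] neumann_nonneg[OF p] by simp
  \<comment> \<open>A point of the cone close to \<open>p\<close> has its nearest-point ball inside
    the cone: this is the interior ball for \<open>hopf\<close>.\<close>
  have "p \<in> closure \<Omega>" using p(1) by (simp add: frontier_iff)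
  then obtain q where q: "q \<in> \<Omega>" "dist q p < norm p / 4"
    using p0 closure_approachable[of p \<Omega>] by (metis zero_less_divide_iff zero_less_norm_iff zero_less_numeral)
  then have "q \<notin> frontier \<Omega>" by (simp add: frontier_iff)
  from touching_ball[OF p(1) p0 q(2) this] obtain y where y: "y \<in> frontier \<Omega>" "y \<noteq> 0"
    "dist q y > 0" "norm q > 2 * dist q y" "ball q (dist q y) \<subseteq> \<Omega> \<or> ball q (dist q y) \<inter> \<Omega> = {}"
    by metis
  have "q \<in> ball q (dist q y)" using y(3) by simp
  then have "ball q (dist q y) \<subseteq> \<Omega>" using y(5) q(1) by blast
  moreover have "norm q > dist q y" using y(3,4) by linarith
  ultimately have "G y \<bullet> (q - y) > 0" using hopf[OF f_zero_nonneg[OF c p] y(1,3)] by blast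
  then show False using gradient_zero[OF c y(1,2)] by simp
qed

end

theorem mainTheorem1:
  fixes \<Omega> :: "(real^'n) set" and k :: 'n and \<beta> c :: real
    and f :: "real \<Rightarrow> real" and u :: "real^'n \<Rightarrow> real"
  assumes dim: "CARD('n) \<ge> 2"
    and cone: "open_cone \<Omega>"
    and half: "\<Omega> \<subseteq> {x. x $ k > 0}"
    and beta: "\<beta> > 0"
    and bdry: "C1beta_boundary_off0 \<Omega> \<beta>"
    and fC1: "\<exists>f'. continuous_on UNIV f' \<and> (\<forall>t. (f has_real_derivative f' t) (at t))"
    and ucont: "continuous_on (closure \<Omega> - {0}) u"
    and uC2: "\<exists>G H. continuous_on (closure \<Omega> - {0}) G \<and> continuous_on \<Omega> H
       \<and> (\<forall>x\<in>\<Omega>. (u has_derivative (\<lambda>h. G x \<bullet> h)) (at x))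
       \<and> (\<forall>x\<in>\<Omega>. (G has_derivative (\<lambda>h. (H x :: real^'n^'n) *v h)) (at x))
       \<and> bounded (u ` \<Omega>) \<and> bounded (G ` \<Omega>)
       \<and> (\<forall>x\<in>\<Omega>. (\<Sum>i\<in>UNIV. H x $ i $ i) + f (u x) = 0 \<and> u x > 0)
       \<and> (\<forall>p\<in>frontier \<Omega> - {0}. u p = 0 \<and>
            (\<forall>\<nu>. exterior_normal \<Omega> p \<nu> \<longrightarrow> G p \<bullet> \<nu> = c))"
  shows "\<Omega> = {x. x $ k > 0}"
proof -
  from fC1 obtain f' where f': "continuous_on UNIV f'" "\<And>t. (f has_real_derivative f' t) (at t)" by blast
  from uC2 obtain G H where GH: "continuous_on (closure \<Omega> - {0}) G" "continuous_on \<Omega> H"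
    "\<forall>x\<in>\<Omega>. (u has_derivative (\<lambda>h. G x \<bullet> h)) (at x)"
    "\<forall>x\<in>\<Omega>. (G has_derivative (\<lambda>h. (H x :: real^'n^'n) *v h)) (at x)"
    "bounded (u ` \<Omega>)" "bounded (G ` \<Omega>)"
    "\<forall>x\<in>\<Omega>. (\<Sum>i\<in>UNIV. H x $ i $ i) + f (u x) = 0 \<and> u x > 0"
    "\<forall>p\<in>frontier \<Omega> - {0}. u p = 0 \<and> (\<forall>\<nu>. exterior_normal \<Omega> p \<nu> \<longrightarrow> G p \<bullet> \<nu> = c)"
    by blast
  interpret overdetermined_cone \<Omega> k \<beta> c f f' u G H
    by unfold_locales (use dim cone half beta bdry f' ucont GH in auto)
  show ?thesis by (rule eq_half_space)
qed

end
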